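(* For all positive integers $t$, $$r(n,t)=\begin{cases}\binom{n-2}{2}+t & \text{for } n\ge 2t+2,\\ \binom{n-1}{2} & \text{for } n=2t+1,\\ \binom{n}{2}-t & \text{for } n=2t.\end{cases}$$
   Context: $r(n,t)$ denotes the maximum number of colors in an edge-coloring of the complete graph $K_n$ that does not have $t$ edge-disjoint rainbow spanning trees. A rainbow spanning tree is a spanning tree whose edges all have distinct colors. *)

theory Defs
  imports Complex_Main "HOL-Library.Ramsey" "HOL-Library.Disjoint_Sets"
begin

text \<open>
  Graphs are simple and undirected; an edge is a two-element set of vertices.  The trees of
  the AFP entry Graph_Theory are not used, because their acyclicity only excludes directed
  cycles.
\<close>

definition complete_edges :: "nat \<Rightarrow> nat set set" where
  "complete_edges n = nsets {..<n} 2"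

definition connected_graph :: "'a set \<Rightarrow> 'a set set \<Rightarrow> bool" where
  "connected_graph V F \<longleftrightarrow> V \<noteq> {} \<and> (\<forall>u\<in>V. \<forall>v\<in>V. (u, v) \<in> {(x, y). {x, y} \<in> F}\<^sup>*)"

definition graph_cycle :: "'a set set \<Rightarrow> 'a list \<Rightarrow> bool" where
  "graph_cycle F vs \<longleftrightarrow> length vs \<ge> 3 \<and> distinct vs \<and>
     (\<forall>i<length vs. {vs ! i, vs ! (Suc i mod length vs)} \<in> F)"

definition tree_graph :: "'a set \<Rightarrow> 'a set set \<Rightarrow> bool" where
  "tree_graph V F \<longleftrightarrow> F \<subseteq> nsets V 2 \<and> connected_graph V F \<and> (\<nexists>vs. graph_cycle F vs)"

definition spanning_tree_complete :: "nat \<Rightarrow> nat set set \<Rightarrow> bool" where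
  "spanning_tree_complete n F \<longleftrightarrow> F \<subseteq> complete_edges n \<and> tree_graph {..<n} F"

definition rainbow_spanning_tree :: "nat \<Rightarrow> (nat set \<Rightarrow> nat) \<Rightarrow> nat set set \<Rightarrow> bool" where
  "rainbow_spanning_tree n c F \<longleftrightarrow> spanning_tree_complete n F \<and> inj_on c F"

definition has_disjoint_rainbow_trees :: "nat \<Rightarrow> nat \<Rightarrow> (nat set \<Rightarrow> nat) \<Rightarrow> bool" where
  "has_disjoint_rainbow_trees n t c \<longleftrightarrow>
     (\<exists>T. (\<forall>i<t. rainbow_spanning_tree n c (T i)) \<and> disjoint_family_on T {..<t})"

text \<open>
  The number of colors of a coloring counts the colors that actually occur on the edges.
\<close>

definition avoiding_color_numbers :: "nat \<Rightarrow> nat \<Rightarrow> nat set" where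
  "avoiding_color_numbers n t =
     {card (c ` complete_edges n) | c. \<not> has_disjoint_rainbow_trees n t c}"

text \<open>
  On finite nonempty sets of natural numbers \<open>Sup\<close> is the maximum, and \<open>Sup {} = 0\<close>.
  The latter matters for \<open>n = 2\<close>, \<open>t = 1\<close>, where every coloring has a rainbow spanning tree.
\<close>

definition rainbow_tree_number :: "nat \<Rightarrow> nat \<Rightarrow> nat" where
  "rainbow_tree_number n t = Sup (avoiding_color_numbers n t)"

lemma finite_avoiding_color_numbers: "finite (avoiding_color_numbers n t)"
proof (rule finite_subset)
  have "finite (complete_edges n)"
    by (simp add: complete_edges_def finite_imp_finite_nsets)
  then show "avoiding_color_numbers n t \<subseteq> {..card (complete_edges n)}"
    by (auto simp: avoiding_color_numbers_def card_image_le)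
qed simp

lemma rainbow_tree_number_eq_Max:
  "avoiding_color_numbers n t \<noteq> {} \<Longrightarrow>
     rainbow_tree_number n t = Max (avoiding_color_numbers n t)"
  by (simp add: rainbow_tree_number_def Sup_nat_def)

end

theory Submission
  imports Defs
begin

text \<open>
  Upper bounds: it suffices to find \<open>t\<close> edge-disjoint spanning trees, not necessarily rainbow, all
  but at most \<open>t - 1\<close> of whose edges belong to a fixed rainbow set, because symmetric exchanges of
  edges between trees then make every tree rainbow. A rainbow set with one more edge than the
  claimed number of colors, together with \<open>t - 1\<close> suitably chosen further edges, has enough edges
  and, for \<open>n \<ge> 2 t + 2\<close>, minimum degree at least \<open>t\<close>. The forest packing argument of Nash-Williams and Tutte gives
  \<open>t\<close> disjoint spanning trees on a set of more than \<open>2 t\<close> vertices (or on all vertices), and these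
  trees extend to all vertices by counting non-edges.

  Lower bounds: give one color to a suitable set of edges and distinct colors to all others. For
  \<open>n \<ge> 2 t + 2\<close> that set consists of all but \<open>t - 1\<close> of the edges at two fixed vertices; each
  spanning tree has two edges at these vertices. In the other cases counting edges is enough.
\<close>

section \<open>Forests and spanning trees\<close>

definition conn :: "'a set set \<Rightarrow> ('a \<times> 'a) set" where
  "conn F = {(x, y). {x, y} \<in> F}\<^sup>*"

text \<open>Acyclicity is put in bridge form: no edge has its endpoints joined by the other edges.
  This suits reachability arguments; the link to \<open>graph_cycle\<close> is
  \<open>forest_acyclic\<close>. Loops are excluded as well, since \<open>conn\<close> is
  reflexive.\<close>

definition forest :: "'a set set \<Rightarrow> bool" where
  "forest F \<longleftrightarrow> (\<forall>x y. {x, y} \<in> F \<longrightarrow> (x, y) \<notin> conn (F - {{x, y}}))"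

definition sptree :: "'a set \<Rightarrow> 'a set set \<Rightarrow> bool" where
  "sptree U F \<longleftrightarrow> F \<subseteq> nsets U 2 \<and> connected_graph U F \<and> forest F"

definition components :: "'a set \<Rightarrow> 'a set set \<Rightarrow> 'a set set" where
  "components V F = (\<lambda>v. conn F `` {v}) ` V"

definition tree_packing :: "'a set \<Rightarrow> 'a set set \<Rightarrow> nat \<Rightarrow> (nat \<Rightarrow> 'a set set) \<Rightarrow> bool" where
  "tree_packing U E t T \<longleftrightarrow>
     (\<forall>i<t. sptree U (T i) \<and> T i \<subseteq> E) \<and> disjoint_family_on T {..<t}"

lemma connected_graph_iff_conn:
  "connected_graph V F \<longleftrightarrow> V \<noteq> {} \<and> (\<forall>u\<in>V. \<forall>v\<in>V. (u, v) \<in> conn F)"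
  by (simp add: connected_graph_def conn_def)

lemma conn_refl [simp]: "(x, x) \<in> conn F"
  by (simp add: conn_def)

lemma conn_trans: "(x, y) \<in> conn F \<Longrightarrow> (y, z) \<in> conn F \<Longrightarrow> (x, z) \<in> conn F"
  unfolding conn_def by (rule rtrancl_trans)

lemma conn_sym: "(x, y) \<in> conn F \<Longrightarrow> (y, x) \<in> conn F"
proof -
  have "sym {(x, y). {x, y} \<in> F}"
    by (auto simp: sym_def insert_commute)
  then show "(x, y) \<in> conn F \<Longrightarrow> (y, x) \<in> conn F"
    unfolding conn_def by (meson sym_rtrancl symD)
qed

lemma conn_edge: "{x, y} \<in> F \<Longrightarrow> (x, y) \<in> conn F"
  by (auto simp: conn_def)

lemma conn_mono: "F \<subseteq> G \<Longrightarrow> conn F \<subseteq> conn G"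
  unfolding conn_def by (rule rtrancl_mono) auto

lemma conn_subset:
  assumes "\<And>x y. {x, y} \<in> F \<Longrightarrow> (x, y) \<in> conn G"
  shows "conn F \<subseteq> conn G"
  unfolding conn_def by (rule rtrancl_subset_rtrancl) (use assms in \<open>auto simp: conn_def\<close>)

text \<open>A walk that uses the new edge can be shortened so that it crosses it only once, in one
  of the two directions.\<close>

lemma conn_insert:
  "(x, y) \<in> conn (insert {a, b} F) \<longleftrightarrow>
     (x, y) \<in> conn F \<or> (x, a) \<in> conn F \<and> (b, y) \<in> conn F \<or> (x, b) \<in> conn F \<and> (a, y) \<in> conn F"
  (is "?L \<longleftrightarrow> ?R y")
proof
  assume ?L
  then have "(x, y) \<in> {(x, y). {x, y} \<in> insert {a, b} F}\<^sup>*"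
    by (simp add: conn_def)
  then show "?R y"
  proof (induction rule: rtrancl_induct)
    case (step y z)
    from step(2) consider "y = a" "z = b" | "y = b" "z = a" | "(y, z) \<in> conn F"
      by (auto simp: doubleton_eq_iff intro: conn_edge)
    then show ?case
    proof cases
      case 3
      then show ?thesis
        using step.IH conn_trans by metis
    qed (use step.IH conn_trans conn_refl in metis)+
  qed simp
next
  have sub: "(u, v) \<in> conn (insert {a, b} F)" if "(u, v) \<in> conn F" for u v
    using that conn_mono[of F "insert {a, b} F"] by blast
  have e: "(a, b) \<in> conn (insert {a, b} F)"
    by (rule conn_edge) simp
  assume "?R y"
  then show ?L
    using conn_trans[OF conn_trans[OF sub e] sub] conn_trans[OF conn_trans[OF sub conn_sym[OF e]] sub] sub
    by (elim disjE) auto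
qed

lemma conn_insert_redundant:
  assumes "(a, b) \<in> conn F"
  shows "conn (insert {a, b} F) = conn F"
proof (rule equalityI)
  show "conn (insert {a, b} F) \<subseteq> conn F"
    by (rule conn_subset) (use assms conn_sym[OF assms] in \<open>auto simp: doubleton_eq_iff intro: conn_edge\<close>)
  show "conn F \<subseteq> conn (insert {a, b} F)"
    by (rule conn_mono) auto
qed

lemma edgeE:
  assumes "e \<in> nsets V 2"
  obtains x y where "e = {x, y}" "x \<noteq> y" "x \<in> V" "y \<in> V"
  using assms by (auto simp: nsets_def card_2_iff)

lemma edge_in_nsets [simp]: "{x, y} \<in> nsets V 2 \<longleftrightarrow> x \<noteq> y \<and> x \<in> V \<and> y \<in> V"
  by (auto simp: nsets_def card_insert_if)

lemma finite_edges: "finite V \<Longrightarrow> F \<subseteq> nsets V 2 \<Longrightarrow> finite F"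
  by (meson finite_imp_finite_nsets finite_subset)

section \<open>Forests: insertion, exchange and paths\<close>

lemma forest_mono:
  assumes "forest F" "G \<subseteq> F"
  shows "forest G"
  unfolding forest_def
proof (intro allI impI notI)
  fix x y
  assume "{x, y} \<in> G" "(x, y) \<in> conn (G - {{x, y}})"
  moreover have "conn (G - {{x, y}}) \<subseteq> conn (F - {{x, y}})"
    using assms(2) by (intro conn_mono) auto
  ultimately show False
    using assms unfolding forest_def by blast
qed

text \<open>If an old edge \<open>{x, y}\<close> could be bypassed by a detour through
  \<open>{a, b}\<close>, the rest of the detour together with \<open>{x, y}\<close> would already
  join \<open>a\<close> to \<open>b\<close> in \<open>F\<close>.\<close>

lemma forest_insert:
  assumes F: "forest F" and ab: "(a, b) \<notin> conn F"
  shows "forest (insert {a, b} F)"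
  unfolding forest_def
proof (intro allI impI notI)
  fix x y
  assume e: "{x, y} \<in> insert {a, b} F" and c: "(x, y) \<in> conn (insert {a, b} F - {{x, y}})"
  have nF: "{a, b} \<notin> F"
    using ab conn_edge by metis
  show False
  proof (cases "{x, y} = {a, b}")
    case True
    then have "insert {a, b} F - {{x, y}} = F"
      using nF by auto
    then show False
      using c ab True conn_sym by (metis doubleton_eq_iff)
  next
    case False
    then have xyF: "{x, y} \<in> F" and eq: "insert {a, b} F - {{x, y}} = insert {a, b} (F - {{x, y}})"
      using e by auto
    have n: "(x, y) \<notin> conn (F - {{x, y}})"
      using F xyF by (simp add: forest_def)
    have sub: "conn (F - {{x, y}}) \<subseteq> conn F"
      by (rule conn_mono) auto
    have "(x, y) \<in> conn F"
      using xyF by (rule conn_edge)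
    then show False
      using c n ab sub unfolding eq conn_insert by (metis conn_sym conn_trans subsetD)
  qed
qed

text \<open>Removing \<open>f\<close> separates \<open>x\<close> from \<open>y\<close>, so every
  connection between them runs through \<open>f\<close>. Hence the new edge \<open>{x, y}\<close>
  again joins the endpoints \<open>a\<close> and \<open>b\<close> of \<open>f\<close>.\<close>

lemma forest_exchange:
  assumes F: "forest F" and f: "f \<in> F" and xy: "(x, y) \<in> conn F" "(x, y) \<notin> conn (F - {f})"
    and fe: "f = {a, b}"
  shows "forest (insert {x, y} (F - {f}))" "conn (insert {x, y} (F - {f})) = conn F"
proof -
  let ?G = "F - {f}"
  show "forest (insert {x, y} ?G)"
    using F xy by (intro forest_insert) (auto intro: forest_mono)
  have Feq: "F = insert {a, b} ?G"
    using f fe by auto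
  have "(x, a) \<in> conn ?G \<and> (b, y) \<in> conn ?G \<or> (x, b) \<in> conn ?G \<and> (a, y) \<in> conn ?G"
    using xy Feq conn_insert[of x y a b ?G] by auto
  then have ab: "(a, b) \<in> conn (insert {x, y} ?G)"
    unfolding conn_insert using conn_sym by metis
  show "conn (insert {x, y} ?G) = conn F"
  proof (rule equalityI)
    show "conn (insert {x, y} ?G) \<subseteq> conn F"
    proof (rule conn_subset)
      fix u v
      assume "{u, v} \<in> insert {x, y} ?G"
      then show "(u, v) \<in> conn F"
        using xy(1) conn_sym[OF xy(1)] by (auto simp: doubleton_eq_iff intro: conn_edge)
    qed
    show "conn F \<subseteq> conn (insert {x, y} ?G)"
    proof (rule conn_subset)
      fix u v
      assume "{u, v} \<in> F"
      then consider "{u, v} = {a, b}" | "{u, v} \<in> insert {x, y} ?G"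
        using fe by auto
      then show "(u, v) \<in> conn (insert {x, y} ?G)"
        using ab conn_sym[OF ab] by cases (auto simp: doubleton_eq_iff intro: conn_edge)
    qed
  qed
qed

text \<open>A smallest edge set \<open>M\<close> joining \<open>x\<close> to \<open>y\<close> plays
  the role of the path of the forest between them. If \<open>y\<close> could be reached in
  \<open>F\<close> without some \<open>f\<close> in \<open>M\<close>, that route and the two pieces
  of \<open>M - {f}\<close> would join the endpoints of \<open>f\<close>, contradicting the forest
  property.\<close>

lemma forest_path:
  assumes fin: "finite F" and F: "forest F" "F \<subseteq> nsets V 2" and xy: "(x, y) \<in> conn F"
  obtains M where "M \<subseteq> F" "(x, y) \<in> conn M" "\<And>f. f \<in> M \<Longrightarrow> (x, y) \<notin> conn (F - {f})"
proof -
  define P where "P = (\<lambda>M. M \<subseteq> F \<and> (x, y) \<in> conn M)"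
  have "P F"
    using xy by (simp add: P_def)
  then obtain M where M: "P M" and minM: "\<And>N. P N \<Longrightarrow> card M \<le> card N"
    using ex_has_least_nat[of P F card] by auto
  have finM: "finite M"
    using M fin finite_subset P_def by auto
  have "(x, y) \<notin> conn (F - {f})" if f: "f \<in> M" for f
  proof
    assume c: "(x, y) \<in> conn (F - {f})"
    obtain a b where ab: "f = {a, b}"
      using f M F(2) edgeE unfolding P_def by blast
    have "card (M - {f}) < card M"
      using f finM by (rule card_Diff1_less[rotated])
    then have n: "(x, y) \<notin> conn (M - {f})"
      using minM[of "M - {f}"] M by (auto simp: P_def)
    have "M = insert {a, b} (M - {f})"
      using f ab by auto
    then have "(x, a) \<in> conn (M - {f}) \<and> (b, y) \<in> conn (M - {f}) \<or>
               (x, b) \<in> conn (M - {f}) \<and> (a, y) \<in> conn (M - {f})"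
      using M n conn_insert[of x y a b "M - {f}"] by (auto simp: P_def)
    moreover have "conn (M - {f}) \<subseteq> conn (F - {f})"
      using M by (intro conn_mono) (auto simp: P_def)
    ultimately have "(x, a) \<in> conn (F - {f}) \<and> (b, y) \<in> conn (F - {f}) \<or>
               (x, b) \<in> conn (F - {f}) \<and> (a, y) \<in> conn (F - {f})"
      by blast
    then have "(a, b) \<in> conn (F - {f})"
      using c conn_sym conn_trans by metis
    then show False
      using F(1) f M ab by (auto simp: forest_def P_def)
  qed
  then show thesis
    using M that by (auto simp: P_def)
qed

section \<open>Component counts and edge numbers\<close>

lemma conn_class_eq: "conn F `` {u} = conn F `` {v} \<longleftrightarrow> (u, v) \<in> conn F"
proof
  assume "conn F `` {u} = conn F `` {v}"
  then show "(u, v) \<in> conn F"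
    by (metis Image_singleton_iff conn_refl)
next
  assume "(u, v) \<in> conn F"
  then show "conn F `` {u} = conn F `` {v}"
    by (intro set_eqI) (metis Image_singleton_iff conn_sym conn_trans)
qed

text \<open>The new edge merges the classes of \<open>a\<close> and \<open>b\<close> into one and
  leaves all others unchanged.\<close>

lemma components_insert:
  assumes "finite V" "a \<in> V" "b \<in> V" "(a, b) \<notin> conn F"
  shows "card (components V F) = Suc (card (components V (insert {a, b} F)))"
proof -
  let ?A = "conn F `` {a}" and ?B = "conn F `` {b}" and ?C = "components V F"
  have ins: "conn (insert {a, b} F) `` {v} =
      (if (a, v) \<in> conn F \<or> (b, v) \<in> conn F then ?A \<union> ?B else conn F `` {v})" for v
  proof (rule set_eqI)
    fix w
    have "(v, w) \<in> conn (insert {a, b} F) \<longleftrightarrow>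
        (if (a, v) \<in> conn F \<or> (b, v) \<in> conn F then (a, w) \<in> conn F \<or> (b, w) \<in> conn F
         else (v, w) \<in> conn F)"
    proof (cases "(a, v) \<in> conn F \<or> (b, v) \<in> conn F")
      case True
      then show ?thesis
        unfolding conn_insert by (metis conn_sym conn_trans)
    next
      case False
      then show ?thesis
        unfolding conn_insert by (metis conn_sym)
    qed
    then show "w \<in> conn (insert {a, b} F) `` {v} \<longleftrightarrow>
        w \<in> (if (a, v) \<in> conn F \<or> (b, v) \<in> conn F then ?A \<union> ?B else conn F `` {v})"
      by simp
  qed
  have AB: "?A \<noteq> ?B" "?A \<in> ?C" "?B \<in> ?C"
    using assms by (auto simp: conn_class_eq components_def)
  have eq: "components V (insert {a, b} F) = insert (?A \<union> ?B) (?C - {?A, ?B})"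
  proof -
    have "v \<in> V \<Longrightarrow> conn F `` {v} \<in> {?A, ?B} \<longleftrightarrow> (a, v) \<in> conn F \<or> (b, v) \<in> conn F" for v
      by (metis conn_class_eq conn_sym insert_iff singletonD)
    then show ?thesis
      unfolding components_def ins using assms(2)
      by (auto simp: image_iff)
  qed
  have notin: "?A \<union> ?B \<notin> ?C - {?A, ?B}"
  proof
    assume "?A \<union> ?B \<in> ?C - {?A, ?B}"
    then obtain v where v: "?A \<union> ?B = conn F `` {v}"
      by (auto simp: components_def)
    then have "(v, a) \<in> conn F" "(v, b) \<in> conn F"
      by (metis Image_singleton_iff UnI1 conn_refl, metis Image_singleton_iff UnI2 conn_refl v)
    then show False
      using assms(4) conn_sym conn_trans by metis
  qed
  have fin: "finite ?C"
    using assms(1) by (simp add: components_def)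
  have two: "card {?A, ?B} = 2"
    using AB(1) by simp
  have "card ?C \<ge> 2"
    using AB(2,3) fin two by (metis card_mono empty_subsetI insert_subset)
  then show ?thesis
    unfolding eq using notin fin AB two by (simp add: card_Diff_subset)
qed

lemma components_empty: "card (components V {}) = card V"
proof -
  have "conn {} = (Id :: ('a \<times> 'a) set)"
    by (simp add: conn_def)
  then show ?thesis
    unfolding components_def by (intro card_image) (auto simp: inj_on_def)
qed

lemma card_le_components:
  assumes "finite V" "finite F" "F \<subseteq> nsets V 2"
  shows "card V \<le> card (components V F) + card F"
  using assms(2,3)
proof (induction F rule: finite_induct)
  case empty
  then show ?case by (simp add: components_empty)
next
  case (insert e F)
  obtain a b where ab: "e = {a, b}" "a \<in> V" "b \<in> V"
    using insert.prems by (metis edgeE insert_subset)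
  have "card (components V F) \<le> Suc (card (components V (insert e F)))"
  proof (cases "(a, b) \<in> conn F")
    case True
    then show ?thesis
      using conn_insert_redundant[of a b F] by (simp add: components_def ab(1))
  next
    case False
    then show ?thesis
      using components_insert[of V a b F] assms(1) ab by simp
  qed
  then show ?case
    using insert by auto
qed

lemma forest_card_components:
  assumes "finite V" "finite F" "F \<subseteq> nsets V 2" "forest F"
  shows "card V = card (components V F) + card F"
  using assms(2-)
proof (induction F rule: finite_induct)
  case empty
  then show ?case by (simp add: components_empty)
next
  case (insert e F)
  obtain a b where ab: "e = {a, b}" "a \<in> V" "b \<in> V"
    using insert.prems by (metis edgeE insert_subset)
  have "insert e F - {e} = F"
    using insert.hyps by auto
  then have "(a, b) \<notin> conn F"
    using insert.prems(2) ab(1) unfolding forest_def by auto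
  then have "card (components V F) = Suc (card (components V (insert e F)))"
    using components_insert[of V a b F] assms(1) ab by simp
  moreover have "forest F"
    using insert.prems(2) by (rule forest_mono) auto
  ultimately show ?case
    using insert by auto
qed

lemma connected_iff_components:
  assumes "finite V" "V \<noteq> {}"
  shows "connected_graph V F \<longleftrightarrow> card (components V F) = 1"
proof
  assume c: "connected_graph V F"
  obtain v where v: "v \<in> V"
    using assms by auto
  have eq: "conn F `` {u} = conn F `` {v}" if "u \<in> V" for u
    using c v that by (simp add: conn_class_eq connected_graph_iff_conn)
  have "components V F = (\<lambda>_. conn F `` {v}) ` V"
    unfolding components_def by (rule image_cong[OF refl]) (rule eq)
  then have "components V F = {conn F `` {v}}"
    using v by auto
  then show "card (components V F) = 1"
    by simp
next
  assume "card (components V F) = 1"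
  then obtain C where C: "components V F = {C}"
    using card_1_singletonE by blast
  show "connected_graph V F"
    unfolding connected_graph_iff_conn
  proof (intro conjI ballI)
    fix u v
    assume "u \<in> V" "v \<in> V"
    then have "conn F `` {u} = C" "conn F `` {v} = C"
      using C by (auto simp: components_def)
    then show "(u, v) \<in> conn F"
      using conn_class_eq by metis
  qed (use assms in auto)
qed

lemma connected_card:
  assumes "finite V" "F \<subseteq> nsets V 2" "connected_graph V F"
  shows "card V \<le> Suc (card F)"
proof -
  have "V \<noteq> {}" "finite F"
    using assms finite_edges[of V F] by (auto simp: connected_graph_def)
  then show ?thesis
    using card_le_components[of V F] connected_iff_components[of V F] assms by auto
qed

lemma forest_card:
  assumes "finite V" "F \<subseteq> nsets V 2" "forest F" "V \<noteq> {}"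
  shows "Suc (card F) \<le> card V"
    and "card V \<le> Suc (card F) \<Longrightarrow> connected_graph V F"
proof -
  have fin: "finite F"
    using assms(1,2) by (rule finite_edges)
  have eq: "card V = card (components V F) + card F"
    using forest_card_components assms fin by blast
  have "card (components V F) \<noteq> 0"
    using assms by (simp add: components_def)
  then show "Suc (card F) \<le> card V" "card V \<le> Suc (card F) \<Longrightarrow> connected_graph V F"
    using eq connected_iff_components[of V F] assms by auto
qed

text \<open>Walking along a cycle from its first to its last vertex avoids the closing edge, whose
  endpoints are therefore joined without it.\<close>

lemma forest_acyclic:
  assumes "forest F"
  shows "\<not> graph_cycle F vs"
proof
  assume c: "graph_cycle F vs"
  define k where "k = length vs"
  have k: "k \<ge> 3" and d: "distinct vs" and e: "\<And>i. i < k \<Longrightarrow> {vs ! i, vs ! (Suc i mod k)} \<in> F"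
    using c by (auto simp: graph_cycle_def k_def)
  let ?G = "F - {{vs ! (k - 1), vs ! 0}}"
  have "(vs ! 0, vs ! i) \<in> conn ?G" if "i < k" for i
    using that
  proof (induction i)
    case (Suc i)
    have "{vs ! i, vs ! Suc i} \<in> F"
      using e[of i] Suc.prems by simp
    moreover have "{vs ! i, vs ! Suc i} \<noteq> {vs ! (k - 1), vs ! 0}"
    proof
      assume "{vs ! i, vs ! Suc i} = {vs ! (k - 1), vs ! 0}"
      then have "vs ! i = vs ! (k - 1) \<or> vs ! i = vs ! 0 \<and> vs ! Suc i = vs ! (k - 1)"
        by (auto simp: doubleton_eq_iff)
      then show False
        by (metis One_nat_def Suc.prems Suc_lessD d k k_def less_imp_diff_less not_less_eq
            nth_eq_iff_index_eq numeral_3_eq_3 order_less_le_trans zero_less_Suc Suc_le_eq Suc_pred)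
    qed
    ultimately have "(vs ! i, vs ! Suc i) \<in> conn ?G"
      by (intro conn_edge) auto
    then show ?case
      using Suc conn_trans by (metis Suc_lessD)
  qed simp
  then have "(vs ! 0, vs ! (k - 1)) \<in> conn ?G"
    using k by simp
  moreover have "{vs ! (k - 1), vs ! 0} \<in> F"
    using e[of "k - 1"] k by simp
  ultimately show False
    using assms conn_sym unfolding forest_def by metis
qed

lemma sptree_card:
  assumes "finite V" "sptree V F"
  shows "card V = Suc (card F)"
proof -
  have "V \<noteq> {}"
    using assms by (auto simp: sptree_def connected_graph_def)
  then show ?thesis
    using assms connected_card[of V F] forest_card(1)[of V F] by (auto simp: sptree_def)
qed

text \<open>Removing \<open>e = {x, y}\<close> splits \<open>S\<close> into two sides. The path of
  \<open>T\<close> from \<open>x\<close> to \<open>y\<close> has to cross between them, and any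
  crossing edge \<open>g\<close> works for both trees: it reconnects \<open>S - {e}\<close>, and
  lying on the path it can be replaced by \<open>e\<close> in \<open>T\<close>.\<close>

lemma sptree_symmetric_exchange:
  assumes fin: "finite V" and S: "sptree V S" and T: "sptree V T" and e: "e \<in> S" "e \<notin> T"
  obtains g where "g \<in> T" "g \<notin> S" "sptree V (insert g (S - {e}))" "sptree V (insert e (T - {g}))"
proof -
  have finST: "finite S" "finite T"
    using S T fin finite_edges unfolding sptree_def by blast+
  obtain x y where xy: "e = {x, y}" "x \<in> V" "y \<in> V" "x \<noteq> y"
    using S e unfolding sptree_def by (meson edgeE subsetD)
  have nS: "(x, y) \<notin> conn (S - {e})"
    using S e xy by (auto simp: sptree_def forest_def)
  have "(x, y) \<in> conn T"
    using T xy by (auto simp: sptree_def connected_graph_iff_conn)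
  then obtain M where M: "M \<subseteq> T" "(x, y) \<in> conn M" "\<And>f. f \<in> M \<Longrightarrow> (x, y) \<notin> conn (T - {f})"
    using forest_path[of T V x y] T finST unfolding sptree_def by blast
  obtain a b where ab: "{a, b} \<in> M" "(a, b) \<notin> conn (S - {e})"
    using conn_subset[of M "S - {e}"] M(2) nS by blast
  let ?g = "{a, b}"
  have gV: "a \<in> V" "b \<in> V" "?g \<in> nsets V 2"
    using ab M T by (auto simp: sptree_def)
  have "?g \<noteq> e"
    using ab M e by auto
  then have gS: "?g \<notin> S"
    using ab(2) conn_edge[of a b "S - {e}"] by auto
  have "(a, b) \<in> conn S"
    using S gV by (auto simp: sptree_def connected_graph_iff_conn)
  then have "forest (insert ?g (S - {e}))" "conn (insert ?g (S - {e})) = conn S"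
    using forest_exchange[of S e a b x y] S e ab(2) xy(1) by (auto simp: sptree_def)
  then have 1: "sptree V (insert ?g (S - {e}))"
    using S gV unfolding sptree_def connected_graph_iff_conn by auto
  have "forest (insert e (T - {?g}))" "conn (insert e (T - {?g})) = conn T"
    using forest_exchange[of T ?g x y a b] T \<open>(x, y) \<in> conn T\<close> ab(1) M xy(1)
    by (auto simp: sptree_def)
  then have "sptree V (insert e (T - {?g}))"
    using T xy unfolding sptree_def connected_graph_iff_conn by auto
  then show thesis
    using that[of ?g] 1 ab M gS by blast
qed

section \<open>Packing disjoint spanning trees\<close>

text \<open>A walk from \<open>a\<close> with edges in \<open>A\<close> never leaves the component
  of \<open>a\<close> in the larger edge set \<open>Z\<close>, so only edges inside this component
  are used.\<close>

lemma conn_restrict: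
  assumes c: "(a, u) \<in> conn A" and A: "A \<subseteq> Z" "A \<subseteq> nsets V 2"
  shows "(a, u) \<in> conn (A \<inter> nsets {v. (a, v) \<in> conn Z} 2)"
proof -
  let ?U = "{v. (a, v) \<in> conn Z}"
  have "(a, u) \<in> {(x, y). {x, y} \<in> A}\<^sup>*"
    using c by (simp add: conn_def)
  then show ?thesis
  proof (induction rule: rtrancl_induct)
    case (step y z)
    have yz: "{y, z} \<in> A"
      using step by simp
    have "(a, y) \<in> conn A"
      using step(1) by (simp add: conn_def)
    then have ay: "(a, y) \<in> conn Z"
      using conn_mono[OF A(1)] by blast
    have "(y, z) \<in> conn Z"
      using yz A(1) by (auto intro: conn_edge)
    then have "(a, z) \<in> conn Z"
      using ay conn_trans by metis
    moreover have "y \<noteq> z"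
      using yz A(2) edge_in_nsets[of y z V] by blast
    ultimately have "{y, z} \<in> A \<inter> nsets ?U 2"
      using yz ay by auto
    then show ?case
      using step.IH conn_edge conn_trans by metis
  qed simp
qed

lemma disjoint_family_on_update:
  assumes "disjoint_family_on F I" "\<And>j. j \<in> I \<Longrightarrow> j \<noteq> i \<Longrightarrow> A \<inter> F j = {}"
  shows "disjoint_family_on (F(i := A)) I"
  using assms unfolding disjoint_family_on_def by (simp add: Int_commute)

lemma sum_card_disjoint:
  fixes F :: "nat \<Rightarrow> 'a set"
  assumes "disjoint_family_on F {..<t}" "\<And>i. i < t \<Longrightarrow> finite (F i)"
  shows "card (\<Union>i<t. F i) = (\<Sum>i<t. card (F i))"
  using assms by (intro card_UN_disjoint) (auto simp: disjoint_family_on_def)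

section \<open>Maximum forest packings and edge replacement\<close>

definition forest_packing :: "'a set set \<Rightarrow> nat \<Rightarrow> (nat \<Rightarrow> 'a set set) \<Rightarrow> bool" where
  "forest_packing E t F \<longleftrightarrow>
     (\<forall>i<t. forest (F i) \<and> F i \<subseteq> E) \<and> disjoint_family_on F {..<t}"

definition unused :: "'a set set \<Rightarrow> nat \<Rightarrow> (nat \<Rightarrow> 'a set set) \<Rightarrow> 'a set set" where
  "unused E t F = E - (\<Union>i<t. F i)"

definition max_packing :: "'a set set \<Rightarrow> nat \<Rightarrow> (nat \<Rightarrow> 'a set set) \<Rightarrow> bool" where
  "max_packing E t F \<longleftrightarrow> forest_packing E t F \<and>
     (\<forall>G. forest_packing E t G \<longrightarrow> card (unused E t F) \<le> card (unused E t G))"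

inductive replace_step :: "'a set set \<Rightarrow> nat \<Rightarrow> (nat \<Rightarrow> 'a set set) \<Rightarrow> (nat \<Rightarrow> 'a set set) \<Rightarrow> bool"
  for E t where
  "i < t \<Longrightarrow> {x, y} \<in> unused E t F \<Longrightarrow> f \<in> F i \<Longrightarrow> (x, y) \<notin> conn (F i - {f}) \<Longrightarrow>
     replace_step E t F (F(i := insert {x, y} (F i - {f})))"

lemma max_packing_conn:
  assumes fin: "finite E" and mp: "max_packing E t F" and e: "{x, y} \<in> unused E t F" and i: "i < t"
  shows "(x, y) \<in> conn (F i)"
proof (rule ccontr)
  assume n: "(x, y) \<notin> conn (F i)"
  let ?G = "F(i := insert {x, y} (F i))"
  have fp: "forest_packing E t F"
    using mp by (simp add: max_packing_def)
  have "forest (insert {x, y} (F i))"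
    using fp i n by (intro forest_insert) (auto simp: forest_packing_def)
  moreover have "disjoint_family_on ?G {..<t}"
    using fp e i by (auto simp: forest_packing_def disjoint_family_on_def unused_def)
  ultimately have "forest_packing E t ?G"
    using fp e by (auto simp: forest_packing_def unused_def)
  then have le: "card (unused E t F) \<le> card (unused E t ?G)"
    using mp by (simp add: max_packing_def)
  have "unused E t ?G \<subseteq> unused E t F - {{x, y}}"
    using i by (auto simp: unused_def split: if_splits)
  moreover have finU: "finite (unused E t F)"
    using fin by (simp add: unused_def)
  ultimately have less: "card (unused E t ?G) < card (unused E t F)"
    using e finU
    by (metis card_Diff1_less card_mono finite_Diff le_less_trans)
  then show False
    using le by simp
qed

lemma replace_step_max_packing:
  assumes fin: "finite E" and E: "E \<subseteq> nsets V 2" and mp: "max_packing E t F"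
    and st: "replace_step E t F G"
  shows "max_packing E t G"
  using st
proof cases
  case (1 i x y f)
  have fp: "forest_packing E t F"
    using mp by (simp add: max_packing_def)
  have fi: "f \<in> E"
    using 1 fp by (auto simp: forest_packing_def)
  then obtain a b where ab: "f = {a, b}"
    using E by (meson edgeE subsetD)
  have "forest (insert {x, y} (F i - {f}))"
    using forest_exchange(1)[of "F i" f x y a b] 1 fp ab max_packing_conn[OF fin mp, of x y i]
    by (auto simp: forest_packing_def)
  moreover have "disjoint_family_on G {..<t}"
  proof -
    have dF: "disjoint_family_on F {..<t}"
      using fp by (simp add: forest_packing_def)
    have "insert {x, y} (F i - {f}) \<inter> F j = {}" if "j \<in> {..<t}" "j \<noteq> i" for j
      using disjoint_family_onD[OF dF, of i j] 1(2,3) that by (auto simp: unused_def)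
    then show ?thesis
      unfolding 1(1) by (rule disjoint_family_on_update[OF dF])
  qed
  ultimately have fpG: "forest_packing E t G"
    using fp 1 by (auto simp: forest_packing_def unused_def)
  have "unused E t G \<subseteq> insert f (unused E t F - {{x, y}})"
    using 1 by (auto simp: unused_def split: if_splits)
  then have "card (unused E t G) \<le> card (insert f (unused E t F - {{x, y}}))"
    using fin by (intro card_mono) (auto simp: unused_def)
  also have "\<dots> \<le> card (unused E t F)"
  proof -
    have "finite (unused E t F)"
      using fin by (auto simp: unused_def)
    then show ?thesis
      using 1(3) card_Suc_Diff1[of "unused E t F" "{x, y}"] card_insert_le_m1
      by (metis card_insert_if finite_Diff le_Suc_eq order_refl)
  qed
  finally show ?thesis
    using fpG mp by (auto simp: max_packing_def intro: order_trans)
qed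

lemma replace_step_frees:
  assumes mp: "max_packing E t F" and st: "i < t" "{x, y} \<in> unused E t F" "f \<in> F i"
  shows "f \<in> unused E t (F(i := insert {x, y} (F i - {f})))"
proof -
  have "f \<in> E" "\<And>j. j < t \<Longrightarrow> j \<noteq> i \<Longrightarrow> f \<notin> F j"
    using mp st unfolding max_packing_def forest_packing_def disjoint_family_on_def by blast+
  then show ?thesis
    using st by (auto simp: unused_def)
qed

text \<open>
  The edge-replacement argument from Diestel's proof of the Nash-Williams--Tutte theorem: let
  \<open>Z\<close> be the set of edges left unused by some packing reachable from a fixed maximum packing.
  Then the endpoints of every edge of \<open>Z\<close> are joined inside \<open>Z\<close> by each forest of the packing.
\<close>

lemma max_packing_core:
  assumes fin: "finite E" and E: "E \<subseteq> nsets V 2" and mp: "max_packing E t F"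
  obtains Z where "unused E t F \<subseteq> Z" "Z \<subseteq> E" "\<And>i. i < t \<Longrightarrow> conn Z \<subseteq> conn (F i \<inter> Z)"
proof -
  define R where "R = (replace_step E t)\<^sup>*\<^sup>* F"
  define Z where "Z = (\<Union>G\<in>{G. R G}. unused E t G)"
  have mpR: "max_packing E t G" if "R G" for G
    using that unfolding R_def
    by (induction rule: rtranclp_induct) (auto intro: mp replace_step_max_packing[OF fin E])
  have local: "(x, y) \<in> conn (G i \<inter> Z)" if G: "R G" "{x, y} \<in> unused E t G" "i < t" for G x y i
  proof -
    have fp: "forest_packing E t G"
      using mpR[OF G(1)] by (simp add: max_packing_def)
    then have "finite (G i)" "forest (G i)" "G i \<subseteq> nsets V 2"
      using G(3) fin E by (auto simp: forest_packing_def intro: finite_subset)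
    then obtain M where M: "M \<subseteq> G i" "(x, y) \<in> conn M" "\<And>f. f \<in> M \<Longrightarrow> (x, y) \<notin> conn (G i - {f})"
      using forest_path max_packing_conn[OF fin mpR[OF G(1)] G(2,3)] by metis
    have "f \<in> Z" if f: "f \<in> M" for f
    proof -
      let ?G = "G(i := insert {x, y} (G i - {f}))"
      have "f \<in> G i"
        using f M by auto
      then have "replace_step E t G ?G" "f \<in> unused E t ?G"
        using G M(3)[OF f] replace_step_frees[OF mpR[OF G(1)]] by (auto intro: replace_step.intros)
      moreover have "R ?G"
        using G(1) calculation(1) unfolding R_def by simp
      ultimately show ?thesis
        by (auto simp: Z_def)
    qed
    then have "M \<subseteq> G i \<inter> Z"
      using M by auto
    then show ?thesis
      using M(2) conn_mono by blast
  qed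
  \<comment> \<open>A replacement adds to forest \<open>i\<close> only an edge whose endpoints
    \<open>local\<close> already joins inside \<open>Z\<close>. So connections inside
    \<open>Z\<close> can be traced back, step by step, to the initial packing
    \<open>F\<close>.\<close>
  have pull: "conn (G i \<inter> Z) \<subseteq> conn (F i \<inter> Z)" if "R G" "i < t" for G i
    using that(1) unfolding R_def
  proof (induction rule: rtranclp_induct)
    case (step G H)
    have RG: "R G"
      using step(1) by (simp add: R_def)
    have "conn (H i \<inter> Z) \<subseteq> conn (G i \<inter> Z)"
      using step(2)
    proof cases
      case (1 j x y f)
      show ?thesis
      proof (cases "j = i")
        case True
        then have "H i \<inter> Z \<subseteq> insert {x, y} (G i \<inter> Z)"
          using 1 by auto
        then have "conn (H i \<inter> Z) \<subseteq> conn (insert {x, y} (G i \<inter> Z))"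
          by (rule conn_mono)
        then show ?thesis
          using conn_insert_redundant[OF local[OF RG 1(3) that(2)]] by simp
      qed (use 1 in simp)
    qed
    then show ?case
      using step.IH by blast
  qed simp
  show thesis
  proof
    have "R F"
      by (simp add: R_def)
    then show "unused E t F \<subseteq> Z"
      by (auto simp: Z_def)
    show "Z \<subseteq> E"
      by (auto simp: Z_def unused_def)
    show "conn Z \<subseteq> conn (F i \<inter> Z)" if "i < t" for i
    proof (rule conn_subset)
      fix x y
      assume "{x, y} \<in> Z"
      then obtain G where "R G" "{x, y} \<in> unused E t G"
        by (auto simp: Z_def)
      then show "(x, y) \<in> conn (F i \<inter> Z)"
        using local pull that by blast
    qed
  qed
qed

lemma dense_tree_packing:
  assumes fin: "finite V" "V \<noteq> {}" and E: "E \<subseteq> nsets V 2" and dense: "t * (card V - 1) \<le> card E"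
  obtains U T where "U \<subseteq> V" "U \<noteq> {}" "tree_packing U E t T"
    "U = V \<or> t * (card U - 1) < card U choose 2"
proof -
  have finE: "finite E"
    using fin E finite_edges by blast
  have "forest_packing E t (\<lambda>_. {})"
    by (auto simp: forest_packing_def forest_def disjoint_family_on_def)
  then obtain F where mp: "max_packing E t F"
    using ex_has_least_nat[of "forest_packing E t" _ "\<lambda>F. card (unused E t F)"]
    unfolding max_packing_def by metis
  then have F: "\<And>i. i < t \<Longrightarrow> forest (F i)" "\<And>i. i < t \<Longrightarrow> F i \<subseteq> E" and disj: "disjoint_family_on F {..<t}"
    by (auto simp: max_packing_def forest_packing_def)
  have finF: "finite (F i)" if "i < t" for i
    using F(2)[OF that] finE by (rule finite_subset)
  show thesis
  proof (cases "unused E t F = {}")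
    case True
    then have "(\<Union>i<t. F i) = E"
      using F(2) by (auto simp: unused_def)
    then have sumE: "(\<Sum>i<t. card (F i)) = card E"
      using sum_card_disjoint[OF disj finF] by auto
    have le: "card (F i) \<le> card V - 1" if "i < t" for i
      using forest_card(1)[OF fin(1) _ F(1)[OF that] fin(2)] F(2)[OF that] E by force
    have eq: "card (F i) = card V - 1" if i: "i < t" for i
    proof (rule ccontr)
      assume "card (F i) \<noteq> card V - 1"
      then have "(\<Sum>i<t. card (F i)) < (\<Sum>i<t. card V - 1)"
        using le i by (intro sum_strict_mono_ex1) force+
      then show False
        using sumE dense by simp
    qed
    have "sptree V (F i)" if i: "i < t" for i
      using forest_card(2)[OF fin(1) _ F(1)[OF i] fin(2)] eq[OF i] F(1)[OF i] F(2)[OF i] E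
      by (auto simp: sptree_def)
    then show thesis
      using that[of V F] F(2) disj fin by (auto simp: tree_packing_def)
  next
    case False
    then obtain e where e: "e \<in> unused E t F"
      by auto
    obtain Z where Z: "unused E t F \<subseteq> Z" "Z \<subseteq> E" "\<And>i. i < t \<Longrightarrow> conn Z \<subseteq> conn (F i \<inter> Z)"
      using max_packing_core[OF finE E mp] by metis
    have "e \<in> nsets V 2"
      using e E by (auto simp: unused_def)
    then obtain a b where ab: "e = {a, b}" "a \<noteq> b" "a \<in> V" "b \<in> V"
      by (metis edgeE)
    define U where "U = {v. (a, v) \<in> conn Z}"
    define T where "T = (\<lambda>i. F i \<inter> nsets U 2)"
    have "v \<in> V" if "(a, v) \<in> conn Z" for v
      using that unfolding conn_def
    proof (induction rule: rtrancl_induct)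
      case (step y z)
      then have "{y, z} \<in> nsets V 2"
        using Z(2) E by blast
      then show ?case
        by simp
    qed (rule ab(3))
    then have UV: "U \<subseteq> V"
      by (auto simp: U_def)
    have finU: "finite U"
      using UV fin(1) by (rule finite_subset)
    have aU: "a \<in> U"
      by (simp add: U_def)
    have "{a, b} \<in> Z"
      using e Z(1) ab(1) by auto
    then have bU: "b \<in> U"
      by (simp add: U_def conn_edge)
    have tree: "sptree U (T i)" if i: "i < t" for i
    proof -
      have "(a, u) \<in> conn (T i)" if u: "u \<in> U" for u
      proof -
        have "(a, u) \<in> conn (F i \<inter> Z)"
          using u Z(3)[OF i] by (auto simp: U_def)
        then have "(a, u) \<in> conn ((F i \<inter> Z) \<inter> nsets U 2)"
          unfolding U_def by (rule conn_restrict[where V = V]) (use Z(2) E in auto)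
        then show ?thesis
          using conn_mono[of "F i \<inter> Z \<inter> nsets U 2" "T i"] by (auto simp: T_def)
      qed
      then have "connected_graph U (T i)"
        using aU conn_sym conn_trans unfolding connected_graph_iff_conn by (metis empty_iff)
      moreover have "forest (T i)"
        using F(1)[OF i] by (rule forest_mono) (auto simp: T_def)
      ultimately show ?thesis
        by (auto simp: sptree_def T_def)
    qed
    have disjT: "disjoint_family_on T {..<t}"
      using disj by (auto simp: T_def disjoint_family_on_def)
    have pack: "tree_packing U E t T"
      using tree F(2) disjT by (auto simp: tree_packing_def T_def)
    have "card (T i) = card U - 1" if "i < t" for i
      using sptree_card[OF finU tree[OF that]] by simp
    then have "t * (card U - 1) = (\<Sum>i<t. card (T i))"
      by simp
    also have "\<dots> = card (\<Union>i<t. T i)"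
      using finF by (intro sum_card_disjoint[symmetric] disjT) (auto simp: T_def)
    also have "\<dots> < card (nsets U 2)"
    proof (rule psubset_card_mono)
      show "finite (nsets U 2)"
        using finU by (rule finite_imp_finite_nsets)
      have "e \<notin> (\<Union>i<t. T i)" "e \<in> nsets U 2"
        using e aU bU ab by (auto simp: T_def unused_def)
      then show "(\<Union>i<t. T i) \<subset> nsets U 2"
        by (auto simp: T_def)
    qed
    finally have "t * (card U - 1) < card U choose 2"
      using card_nsets by metis
    then show thesis
      using that UV aU pack by blast
  qed
qed

section \<open>Rainbow rearrangement\<close>

text \<open>If each of \<open>t\<close> disjoint sets met \<open>M\<close>, choosing one common
  element per set would give \<open>t\<close> distinct elements of \<open>M\<close>.\<close>

lemma disjoint_family_avoids:
  assumes "finite M" "card M < t" "disjoint_family_on S {..<t}"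
  obtains b where "b < t" "S b \<inter> M = {}"
proof (rule ccontr)
  assume "\<not> thesis"
  then have "\<forall>i\<in>{..<t}. \<exists>f. f \<in> S i \<inter> M"
    using that by blast
  then obtain f where f: "\<And>i. i < t \<Longrightarrow> f i \<in> S i \<inter> M"
    by (metis lessThan_iff)
  have "inj_on f {..<t}"
    using f assms(3) unfolding inj_on_def disjoint_family_on_def by (metis IntE IntI empty_iff lessThan_iff)
  moreover have "f ` {..<t} \<subseteq> M"
    using f by auto
  ultimately have "card {..<t} \<le> card M"
    using assms(1) by (rule card_inj_on_le)
  then show False
    using assms(2) by simp
qed

lemma tree_packing_exchange:
  assumes fin: "finite V" and S: "tree_packing V Q t S" and ab: "a < t" "b < t" "a \<noteq> b" and e: "e \<in> S a"
  obtains g where "g \<in> S b"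
    "tree_packing V Q t (S(a := insert g (S a - {e}), b := insert e (S b - {g})))"
proof -
  have S': "\<And>i. i < t \<Longrightarrow> sptree V (S i)" "\<And>i. i < t \<Longrightarrow> S i \<subseteq> Q"
    and disj: "disjoint_family_on S {..<t}"
    using S by (auto simp: tree_packing_def)
  have dj: "S i \<inter> S j = {}" if "i < t" "j < t" "i \<noteq> j" for i j
    using disjoint_family_onD[OF disj] that by simp
  have "e \<notin> S b"
    using dj[of a b] ab e by auto
  then obtain g where g: "g \<in> S b" "g \<notin> S a" "sptree V (insert g (S a - {e}))"
      "sptree V (insert e (S b - {g}))"
    using sptree_symmetric_exchange[OF fin S'(1)[OF ab(1)] S'(1)[OF ab(2)] e] by metis
  let ?A = "insert g (S a - {e})" and ?B = "insert e (S b - {g})"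
  have AB: "?A \<inter> ?B = {}"
    using dj[of a b] ab e g(1,2) by auto
  have A: "?A \<inter> S j = {}" and B: "?B \<inter> S j = {}" if "j < t" "j \<noteq> a" "j \<noteq> b" for j
    using dj[of a j] dj[of b j] ab e g(1) that by auto
  \<comment> \<open>Emptying position \<open>b\<close> first allows one update at a time:
    \<open>?A\<close> contains \<open>g\<close>, which still belongs to \<open>S b\<close>.\<close>
  have "disjoint_family_on (S(b := {}, a := ?A, b := ?B)) {..<t}"
  proof (intro disjoint_family_on_update disj)
    fix j
    assume "j \<in> {..<t}" "j \<noteq> a"
    then show "?A \<inter> (S(b := {})) j = {}"
      using A by simp
  next
    fix j
    assume "j \<in> {..<t}" "j \<noteq> b"
    then show "?B \<inter> (S(b := {}, a := ?A)) j = {}"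
      using AB B by (cases "j = a") (simp_all add: Int_commute)
  qed simp
  then have "disjoint_family_on (S(a := ?A, b := ?B)) {..<t}"
    using ab(3) by (simp add: fun_upd_twist[of b a])
  moreover have "g \<in> Q" "e \<in> Q"
    using subsetD[OF S'(2)[OF ab(2)] g(1)] subsetD[OF S'(2)[OF ab(1)] e] by auto
  ultimately have "tree_packing V Q t (S(a := ?A, b := ?B))"
    using S' g(3,4) ab unfolding tree_packing_def by auto
  then show thesis
    using that g(1) by blast
qed

text \<open>
  Call the edges outside the rainbow set \<open>H\<close> marked. Exchanges first spread the marked edges over
  distinct trees. As there are fewer than \<open>t\<close> of them, some tree \<open>b\<close> has no marked edge. A tree
  that is not rainbow then has one marked edge, and exchanging the unique edge of \<open>H\<close> of the same
  color with tree \<open>b\<close> repairs it without spoiling any other tree.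
\<close>

lemma rainbow_rearrangement:
  assumes fin: "finite V" and T: "tree_packing V Q t T" and inj: "inj_on c H"
    and few: "finite (Q - H)" "card (Q - H) < t"
  obtains S where "tree_packing V Q t S" "\<And>i. i < t \<Longrightarrow> inj_on c (S i)"
proof -
  define M where "M = Q - H"
  define m1 where "m1 = (\<lambda>S. card {i. i < t \<and> S i \<inter> M = {}})"
  obtain S1 where S1: "tree_packing V Q t S1" and min1: "\<And>S. tree_packing V Q t S \<Longrightarrow> m1 S1 \<le> m1 S"
    using ex_has_least_nat[of "tree_packing V Q t" T m1] T by auto
  have free: "\<exists>b<t. S b \<inter> M = {}" if "tree_packing V Q t S" for S
  proof -
    have "finite M" "card M < t" "disjoint_family_on S {..<t}"
      using few that by (auto simp: M_def tree_packing_def)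
    then obtain b where "b < t" "S b \<inter> M = {}"
      by (rule disjoint_family_avoids)
    then show ?thesis
      by blast
  qed
  define P where "P = (\<lambda>S. tree_packing V Q t S \<and> (\<forall>i<t. \<forall>f\<in>S i \<inter> M. \<forall>g\<in>S i \<inter> M. f = g))"
  have "P S1"
    unfolding P_def
  proof (intro conjI allI impI ballI S1)
    fix a f h
    assume a: "a < t" and fh: "f \<in> S1 a \<inter> M" "h \<in> S1 a \<inter> M"
    show "f = h"
    proof (rule ccontr)
      assume ne: "f \<noteq> h"
      obtain b where b: "b < t" "S1 b \<inter> M = {}"
        using free[OF S1] by auto
      have ab: "a \<noteq> b"
        using b fh by auto
      obtain g where g: "g \<in> S1 b"
          "tree_packing V Q t (S1(a := insert g (S1 a - {f}), b := insert f (S1 b - {g})))"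
        using tree_packing_exchange[OF fin S1 a b(1) ab, of f] fh by blast
      let ?S = "S1(a := insert g (S1 a - {f}), b := insert f (S1 b - {g}))"
      \<comment> \<open>Tree \<open>a\<close> keeps the marked edge \<open>h\<close> and tree
        \<open>b\<close> receives \<open>f\<close>, so there is one unmarked tree less than in
        \<open>S1\<close>.\<close>
      have "{i. i < t \<and> ?S i \<inter> M = {}} \<subseteq> {i. i < t \<and> S1 i \<inter> M = {}} - {b}"
        using fh ne by (auto split: if_splits)
      then have "m1 ?S \<le> card ({i. i < t \<and> S1 i \<inter> M = {}} - {b})"
        unfolding m1_def by (intro card_mono) auto
      also have "\<dots> < m1 S1"
        unfolding m1_def using b by (intro card_Diff1_less) auto
      finally show False
        using min1[OF g(2)] by simp
    qed
  qed
  define m2 where "m2 = (\<lambda>S. card {i. i < t \<and> \<not> inj_on c (S i)})"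
  obtain S where S: "P S" and min2: "\<And>R. P R \<Longrightarrow> m2 S \<le> m2 R"
    using ex_has_least_nat[of P S1 m2] \<open>P S1\<close> by auto
  have pS: "tree_packing V Q t S"
    using S by (simp add: P_def)
  have "inj_on c (S a)" if a: "a < t" for a
  proof (rule ccontr)
    assume "\<not> inj_on c (S a)"
    then obtain f0 h0 where fh0: "f0 \<in> S a" "h0 \<in> S a" "f0 \<noteq> h0" "c f0 = c h0"
      by (auto simp: inj_on_def)
    have SQ: "S a \<subseteq> Q"
      using pS a by (auto simp: tree_packing_def)
    have "\<not> (f0 \<in> M \<and> h0 \<in> M)"
      using S a fh0 unfolding P_def by blast
    moreover have "\<not> (f0 \<in> H \<and> h0 \<in> H)"
      using inj fh0 by (auto simp: inj_on_def)
    ultimately consider "f0 \<in> M" "h0 \<in> H" | "h0 \<in> M" "f0 \<in> H"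
      using fh0(1,2) SQ unfolding M_def by blast
    then obtain f e where fe: "f \<in> S a \<inter> M" "e \<in> S a" "e \<in> H" "c e = c f"
    proof cases
      case 1
      then show thesis
        using fh0 that[of f0 h0] by simp
    next
      case 2
      then show thesis
        using fh0 that[of h0 f0] by simp
    qed
    obtain b where b: "b < t" "S b \<inter> M = {}"
      using free[OF pS] by auto
    have ab: "a \<noteq> b"
      using b fe by auto
    obtain g where g: "g \<in> S b"
        "tree_packing V Q t (S(a := insert g (S a - {e}), b := insert e (S b - {g})))"
      using tree_packing_exchange[OF fin pS a b(1) ab fe(2)] by blast
    let ?A = "insert g (S a - {e})" and ?B = "insert e (S b - {g})"
    let ?S = "S(a := ?A, b := ?B)"
    have "S b \<subseteq> Q"
      using pS b(1) by (auto simp: tree_packing_def)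
    then have SbH: "S b \<subseteq> H"
      using b(2) by (auto simp: M_def)
    have eM: "e \<notin> M" "g \<notin> M"
      using fe g b(2) by (auto simp: M_def)
    have oneA: "x = f" if "x \<in> S a \<inter> M" for x
      using S a fe(1) that unfolding P_def by blast
    have AM: "?A \<inter> M \<subseteq> {f}" and BM: "?B \<inter> M = {}"
      using oneA eM b(2) by auto
    have "P ?S"
      unfolding P_def
    proof (intro conjI allI impI ballI g(2))
      fix i x y
      assume i: "i < t" and xy: "x \<in> ?S i \<inter> M" "y \<in> ?S i \<inter> M"
      consider "i = b" | "i = a" | "i \<noteq> a" "i \<noteq> b"
        by blast
      then show "x = y"
      proof cases
        case 3
        then have "x \<in> S i \<inter> M" "y \<in> S i \<inter> M"
          using xy by auto
        then show ?thesis
          using S i unfolding P_def by blast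
      next
        case 1
        then have "x \<in> ?B \<inter> M"
          using xy by simp
        then show ?thesis
          using BM by blast
      next
        case 2
        then have "x \<in> ?A \<inter> M" "y \<in> ?A \<inter> M"
          using xy ab by simp_all
        then show ?thesis
          using AM by blast
      qed
    qed
    have "e \<notin> S b"
      using pS a b(1) ab fe(2) disjoint_family_onD[of S "{..<t}" a b] by (auto simp: tree_packing_def)
    then have ge: "g \<noteq> e"
      using g(1) by auto
    \<comment> \<open>Apart from \<open>f\<close>, the new tree \<open>a\<close> consists of edges
      of \<open>H\<close> other than \<open>e\<close>. As \<open>c\<close> is injective on
      \<open>H\<close>, none of them has the color \<open>c e = c f\<close>.\<close>
    have AH: "?A - {f} \<subseteq> H - {e}"
      using oneA SQ SbH g(1) ge unfolding M_def by blast
    have "inj_on c ?A"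
    proof -
      have fA: "f \<in> ?A"
        using fe unfolding M_def by blast
      have "inj_on c (?A - {f})"
        using inj AH by (meson Diff_subset inj_on_subset subset_trans)
      moreover have "c f \<notin> c ` (?A - {f})"
      proof
        assume "c f \<in> c ` (?A - {f})"
        then obtain h where "h \<in> ?A - {f}" "c h = c e"
          using fe(4) by (metis imageE)
        then show False
          using AH inj fe(3) by (metis Diff_iff inj_onD insertI1 subsetD)
      qed
      ultimately have "inj_on c (insert f (?A - {f}))"
        unfolding inj_on_insert by (metis Diff_idemp)
      then show ?thesis
        using fA by (simp only: insert_Diff)
    qed
    moreover have "inj_on c ?B"
      using SbH fe(3) by (intro inj_on_subset[OF inj]) auto
    ultimately have "{i. i < t \<and> \<not> inj_on c (?S i)} \<subseteq> {i. i < t \<and> \<not> inj_on c (S i)} - {a}"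
      using ab by (auto split: if_splits)
    then have "m2 ?S \<le> card ({i. i < t \<and> \<not> inj_on c (S i)} - {a})"
      unfolding m2_def by (intro card_mono) auto
    also have "\<dots> < m2 S"
      unfolding m2_def using a \<open>\<not> inj_on c (S a)\<close> by (intro card_Diff1_less) auto
    finally show False
      using min2[OF \<open>P ?S\<close>] by simp
  qed
  then show thesis
    using that pS by blast
qed

section \<open>Upper bounds\<close>

lemma tree_packing_extend:
  assumes finU: "finite U" and T: "tree_packing U E t T" and z: "z \<notin> U"
    and deg: "t \<le> card {x \<in> U. {z, x} \<in> E}"
  obtains T' where "tree_packing (insert z U) E t T'"
proof -
  have "card {..<t} \<le> card {x \<in> U. {z, x} \<in> E}"
    using deg by simp
  then obtain g where g: "inj_on g {..<t}" "g ` {..<t} \<subseteq> {x \<in> U. {z, x} \<in> E}"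
    using card_le_inj[of "{..<t}" "{x \<in> U. {z, x} \<in> E}"] finU by auto
  \<comment> \<open>The vertex \<open>z\<close> becomes a leaf of every tree. Its neighbors
    \<open>g i\<close> are distinct, so the trees stay edge-disjoint.\<close>
  define T' where "T' = (\<lambda>i. insert {z, g i} (T i))"
  have gU: "g i \<in> U" "{z, g i} \<in> E" if "i < t" for i
    using g(2) that by auto
  have TU: "T i \<subseteq> nsets U 2" if "i < t" for i
    using T that by (auto simp: tree_packing_def sptree_def)
  have nz: "{z, x} \<notin> T i" if "i < t" for i x
    using TU[OF that] z edge_in_nsets[of z x U] by blast
  have "sptree (insert z U) (T' i)" if i: "i < t" for i
  proof -
    have tree: "connected_graph U (T i)" "forest (T i)"
      using T i by (auto simp: tree_packing_def sptree_def)
    have "y = z" if "(z, y) \<in> conn (T i)" for y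
      using that unfolding conn_def
      by (induction rule: rtrancl_induct) (use nz[OF i] in auto)
    then have "(z, g i) \<notin> conn (T i)"
      using gU[OF i] z by auto
    then have "forest (T' i)"
      unfolding T'_def using tree(2) by (intro forest_insert)
    moreover have "T' i \<subseteq> nsets (insert z U) 2"
      using TU[OF i] gU[OF i] z nsets_mono[of U "insert z U" 2] by (auto simp: T'_def)
    moreover have "connected_graph (insert z U) (T' i)"
    proof -
      have "(g i, u) \<in> conn (T' i)" if u: "u \<in> insert z U" for u
      proof (cases "u = z")
        case True
        then show ?thesis
          by (intro conn_edge) (auto simp: T'_def insert_commute)
      next
        case False
        then have "(g i, u) \<in> conn (T i)"
          using u tree(1) gU[OF i] by (auto simp: connected_graph_iff_conn)
        then show ?thesis
          using conn_mono[of "T i" "T' i"] by (auto simp: T'_def)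
      qed
      then show ?thesis
        unfolding connected_graph_iff_conn using conn_sym conn_trans by (metis insert_not_empty)
    qed
    ultimately show ?thesis
      by (simp add: sptree_def)
  qed
  moreover have "T' i \<subseteq> E" if "i < t" for i
    using T gU[OF that] that by (auto simp: tree_packing_def T'_def)
  moreover have "disjoint_family_on T' {..<t}"
    unfolding disjoint_family_on_def
  proof (intro ballI impI)
    fix m n
    assume mn: "m \<in> {..<t}" "n \<in> {..<t}" "m \<noteq> n"
    have "T m \<inter> T n = {}"
      using T mn by (auto simp: tree_packing_def disjoint_family_on_def)
    moreover have "{z, g m} \<noteq> {z, g n}"
      using g(1) mn gU z by (auto simp: doubleton_eq_iff inj_on_def)
    ultimately show "T' m \<inter> T' n = {}"
      using nz mn by (auto simp: T'_def)
  qed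
  ultimately have "tree_packing (insert z U) E t T'"
    by (simp add: tree_packing_def)
  then show thesis
    by (rule that)
qed

lemma choose_two_Suc: "Suc k choose 2 = k + (k choose 2)"
  by (simp add: numeral_2_eq_2)

lemma two_times_choose_two: "2 * (k choose 2) + k = k * k"
  by (induction k) (auto simp: choose_two_Suc algebra_simps)

lemma choose_two_gt:
  assumes "t * (u - 1) < u choose 2"
  shows "2 * t < u"
proof (cases u)
  case (Suc k)
  have "2 * (u choose 2) = (k + 1) * k"
    using two_times_choose_two[of k] by (simp add: Suc choose_two_Suc)
  then have "2 * t * k < (k + 1) * k"
    using assms Suc by simp
  then have "2 * t < k + 1"
    using mult_less_cancel2 by blast
  then show ?thesis
    using Suc by simp
qed (use assms in simp)

text \<open>The edge count gives a packing on some set of more than \<open>2 * t\<close> vertices;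
  let \<open>U\<close> be a largest such set. By \<open>tree_packing_extend\<close> each outside
  vertex has fewer than \<open>t\<close> neighbors in \<open>U\<close>. A single outside vertex
  would violate the degree condition, and two or more would force more non-edges than
  \<open>E\<close> leaves.\<close>

lemma min_degree_tree_packing:
  assumes fin: "finite V" and n: "2 * t + 2 \<le> card V" and E: "E \<subseteq> nsets V 2"
    and size: "(card V - 2 choose 2) + 2 * t \<le> card E"
    and deg: "\<And>v. v \<in> V \<Longrightarrow> t \<le> card {e \<in> E. v \<in> e}"
  obtains T where "tree_packing V E t T"
proof -
  define k where "k = card V - 2"
  have k: "card V = k + 2" "2 * t \<le> k"
    using n by (auto simp: k_def)
  have ne: "V \<noteq> {}"
    using k by auto
  obtain j where j: "k = 2 * t + j"
    using k(2) le_Suc_ex by blast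
  \<comment> \<open>With \<open>k = 2 * t + j\<close> the right side exceeds the left one by
    \<open>(k - 1) * j\<close>. The inequality is twice the density condition of
    \<open>dense_tree_packing\<close>, with \<open>k\<close> added on both sides.\<close>
  have "2 * (t * (k + 1)) + k \<le> k * k + 4 * t"
    unfolding j by (cases j) (auto simp: algebra_simps)
  also have "\<dots> = 2 * ((k choose 2) + 2 * t) + k"
    using two_times_choose_two[of k] by simp
  finally have "t * (card V - 1) \<le> card E"
    using size k(1) by simp
  then obtain U0 T0 where U0: "U0 \<subseteq> V" "tree_packing U0 E t T0"
      "U0 = V \<or> t * (card U0 - 1) < card U0 choose 2"
    using dense_tree_packing[OF fin ne E] by metis
  define P where "P = (\<lambda>U. U \<subseteq> V \<and> 2 * t < card U \<and> (\<exists>T. tree_packing U E t T))"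
  have "P U0"
    using U0 choose_two_gt n unfolding P_def by fastforce
  moreover have "\<forall>U. P U \<longrightarrow> card U < Suc (card V)"
    using fin by (auto simp: P_def card_mono less_Suc_eq_le)
  ultimately obtain U where PU: "P U" and max: "\<And>U'. P U' \<Longrightarrow> card U' \<le> card U"
    using ex_has_greatest_nat[of P U0 card] by metis
  then obtain T where UV: "U \<subseteq> V" and Ut: "2 * t < card U" and T: "tree_packing U E t T"
    by (auto simp: P_def)
  have finU: "finite U"
    using UV fin by (rule finite_subset)
  have few: "card {x \<in> U. {z, x} \<in> E} < t" if z: "z \<in> V - U" for z
  proof (rule ccontr)
    assume "\<not> card {x \<in> U. {z, x} \<in> E} < t"
    then obtain T' where "tree_packing (insert z U) E t T'"
      using tree_packing_extend[OF finU T, of z] z by auto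
    then have "P (insert z U)"
      using z UV Ut finU by (auto simp: P_def)
    then show False
      using max[of "insert z U"] z finU by auto
  qed
  have "U = V"
  proof (rule ccontr)
    assume "U \<noteq> V"
    define w where "w = card (V - U)"
    have w: "card V = card U + w"
      using card_Diff_subset[OF finU UV] card_mono[OF fin UV] by (simp add: w_def)
    have "V - U \<noteq> {}"
      using UV \<open>U \<noteq> V\<close> by auto
    then have "w \<noteq> 0"
      using fin by (simp add: w_def)
    moreover have "w \<noteq> 1"
    proof
      assume "w = 1"
      then obtain z where z: "V - U = {z}"
        unfolding w_def using card_1_singletonE by blast
      have "{e \<in> E. z \<in> e} \<subseteq> (\<lambda>x. {z, x}) ` {x \<in> U. {z, x} \<in> E}"
      proof
        fix e
        assume e: "e \<in> {e \<in> E. z \<in> e}"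
        then obtain x y where "e = {x, y}" "x \<noteq> y" "x \<in> V" "y \<in> V"
          using E edgeE by (metis (no_types, lifting) mem_Collect_eq subsetD)
        then obtain v where v: "e = {z, v}" "v \<in> V" "v \<noteq> z"
          using e by (auto simp: insert_commute)
        then have "v \<in> U"
          using z by auto
        then show "e \<in> (\<lambda>x. {z, x}) ` {x \<in> U. {z, x} \<in> E}"
          using e v by auto
      qed
      then have "card {e \<in> E. z \<in> e} \<le> card {x \<in> U. {z, x} \<in> E}"
        using finU by (intro surj_card_le) auto
      then show False
        using few[of z] deg[of z] z by auto
    qed
    ultimately have w2: "w \<ge> 2"
      by simp
    \<comment> \<open>The non-edges between \<open>V - U\<close> and \<open>U\<close>: each outside
      vertex has at least \<open>card U - (t - 1)\<close> of them.\<close>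
    define K where "K = (SIGMA z:V - U. {x \<in> U. {z, x} \<notin> E})"
    have "w * (card U + 1 - t) = (\<Sum>z\<in>V - U. card U + 1 - t)"
      by (simp add: w_def)
    also have "\<dots> \<le> (\<Sum>z\<in>V - U. card {x \<in> U. {z, x} \<notin> E})"
    proof (rule sum_mono)
      fix z
      assume z: "z \<in> V - U"
      have "{x \<in> U. {z, x} \<notin> E} = U - {x \<in> U. {z, x} \<in> E}"
        by auto
      then have "card {x \<in> U. {z, x} \<notin> E} = card U - card {x \<in> U. {z, x} \<in> E}"
        using finU by (simp add: card_Diff_subset)
      then show "card U + 1 - t \<le> card {x \<in> U. {z, x} \<notin> E}"
        using few[OF z] by linarith
    qed
    also have "\<dots> = card K"
      unfolding K_def using fin finU by (intro card_SigmaI[symmetric]) auto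
    also have "\<dots> \<le> card (nsets V 2 - E)"
    proof (rule card_inj_on_le)
      show "inj_on (\<lambda>(z, x). {z, x}) K"
        by (auto simp: K_def inj_on_def doubleton_eq_iff)
      show "(\<lambda>(z, x). {z, x}) ` K \<subseteq> nsets V 2 - E"
        using UV by (auto simp: K_def)
      show "finite (nsets V 2 - E)"
        using fin by (simp add: finite_imp_finite_nsets)
    qed
    also have "\<dots> = (card V choose 2) - card E"
      using E finite_edges[OF fin E] by (simp add: card_Diff_subset)
    finally have le: "w * (card U + 1 - t) \<le> (card V choose 2) - card E" .
    \<comment> \<open>At most \<open>2 * k + 1 - 2 * t\<close> non-edges exist, while
      \<open>K\<close> has at least \<open>w * (t + p + 2)\<close>, which is at least
      \<open>2 * (t + p) + 2 * w\<close>. Since \<open>k + 2 = 2 * t + 1 + p + w\<close>, the lower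
      bound is larger by exactly one.\<close>
    define p where "p = card U - (2 * t + 1)"
    have p: "card U = 2 * t + 1 + p"
      using Ut by (simp add: p_def)
    have "card V choose 2 = 2 * k + 1 + (k choose 2)"
      by (simp add: k(1) choose_two_Suc)
    then have "w * (card U + 1 - t) + 2 * t \<le> 2 * k + 1"
      using le size k by simp
    moreover have "w * (card U + 1 - t) = w * (t + p) + 2 * w"
      by (simp add: p algebra_simps)
    moreover have "2 * (t + p) \<le> w * (t + p)"
      using w2 by (rule mult_le_mono1)
    ultimately have "2 * (t + p) + 2 * w + 2 * t \<le> 2 * k + 1"
      by (metis add_le_mono1 order_trans)
    moreover have "k + 2 = 2 * t + 1 + p + w"
      using w k(1) p by simp
    ultimately show False
      by presburger
  qed
  then show thesis
    using T that by blast
qed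

section \<open>Choosing the rainbow set and the further edges\<close>

lemma card_star:
  assumes "finite V" "v \<in> V"
  shows "card {e \<in> nsets V 2. v \<in> e} = card V - 1"
proof -
  have "{e \<in> nsets V 2. v \<in> e} = (\<lambda>x. {v, x}) ` (V - {v})"
    using assms(2) by (auto elim!: edgeE simp: insert_commute)
  moreover have "inj_on (\<lambda>x. {v, x}) (V - {v})"
    by (auto simp: inj_on_def doubleton_eq_iff)
  ultimately show ?thesis
    using assms by (simp add: card_image)
qed

lemma card_le_degree_sum:
  assumes "finite V" "H \<subseteq> nsets V 2" "A \<subseteq> V"
  shows "card H \<le> (card V - card A choose 2) + (\<Sum>a\<in>A. card {e \<in> H. a \<in> e})"
proof -
  have fin: "finite A" "finite H"
    using assms finite_subset finite_edges by blast+
  have "H \<subseteq> nsets (V - A) 2 \<union> (\<Union>a\<in>A. {e \<in> H. a \<in> e})"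
    using assms(2) by (auto simp: nsets_def)
  then have "card H \<le> card (nsets (V - A) 2 \<union> (\<Union>a\<in>A. {e \<in> H. a \<in> e}))"
    using assms(1) fin by (intro card_mono) (auto simp: finite_imp_finite_nsets)
  also have "\<dots> \<le> card (nsets (V - A) 2) + card (\<Union>a\<in>A. {e \<in> H. a \<in> e})"
    by (rule card_Un_le)
  also have "\<dots> \<le> card (nsets (V - A) 2) + (\<Sum>a\<in>A. card {e \<in> H. a \<in> e})"
    using card_UN_le[OF fin(1)] by simp
  finally show ?thesis
    using assms fin by (simp add: card_Diff_subset)
qed

lemma rainbow_subset:
  assumes "m \<le> card (c ` E)"
  obtains H where "H \<subseteq> E" "inj_on c H" "card H = m"
proof -
  obtain C where C: "C \<subseteq> c ` E" "card C = m"
    using assms obtain_subset_with_card_n by metis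
  then obtain H where "H \<subseteq> E" "C = c ` H" "inj_on c H"
    using subset_image_inj by metis
  then show thesis
    using that C card_image by metis
qed

text \<open>If \<open>x\<close> is isolated in a rainbow set \<open>H\<close>, an edge
  \<open>s\<close> at \<open>x\<close> is swapped in for the edge of \<open>H\<close> with the same
  color, or for any edge if that color is absent. Then \<open>x\<close> has degree one, and a second
  vertex \<open>v\<close> of degree zero would leave at most
  \<open>(card V - 2 choose 2) + 1\<close> edges, which is too few.\<close>

lemma rainbow_subset_positive_degrees:
  assumes fin: "finite V" and n: "2 * t + 2 \<le> card V" and t: "1 \<le> t"
    and col: "(card V - 2 choose 2) + t + 1 \<le> card (c ` nsets V 2)"
  obtains H where "H \<subseteq> nsets V 2" "inj_on c H" "card H = (card V - 2 choose 2) + t + 1"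
    "\<And>v. v \<in> V \<Longrightarrow> 1 \<le> card {e \<in> H. v \<in> e}"
proof -
  obtain H where H: "H \<subseteq> nsets V 2" "inj_on c H" "card H = (card V - 2 choose 2) + t + 1"
    using rainbow_subset[OF col] by metis
  have finH: "finite H"
    using finite_edges[OF fin H(1)] .
  show thesis
  proof (cases "\<forall>v\<in>V. 1 \<le> card {e \<in> H. v \<in> e}")
    case True
    then show thesis
      using that H by blast
  next
    case False
    then obtain x where x: "x \<in> V" "card {e \<in> H. x \<in> e} = 0"
      by force
    then have xH: "\<And>e. e \<in> H \<Longrightarrow> x \<notin> e"
      using finH by auto
    have "V - {x} \<noteq> {}"
      using n card_mono[of "{x}" V] by auto
    then obtain a where a: "a \<in> V" "a \<noteq> x"
      by auto
    define s where "s = {x, a}"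
    have s: "s \<in> nsets V 2" "s \<notin> H" "x \<in> s"
      using x a xH by (auto simp: s_def)
    obtain h where h: "h \<in> H" "c s \<in> c ` H \<Longrightarrow> c h = c s"
    proof (cases "c s \<in> c ` H")
      case True
      then show thesis
        using that by auto
    next
      case False
      have "H \<noteq> {}"
        using H(3) by auto
      then show thesis
        using that False by auto
    qed
    define H' where "H' = insert s (H - {h})"
    have "c s \<notin> c ` (H - {h})"
    proof
      assume "c s \<in> c ` (H - {h})"
      then obtain g where "g \<in> H - {h}" "c g = c s"
        by (metis imageE)
      then show False
        using h H(2) by (metis DiffD1 DiffD2 image_eqI inj_onD insertI1)
    qed
    then have "inj_on c H'"
      using H(2) by (auto simp: H'_def inj_on_diff)
    moreover have "H' \<subseteq> nsets V 2"
      using H(1) s(1) by (auto simp: H'_def)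
    moreover have cH': "card H' = card H"
      using finH h(1) s(2) card_Suc_Diff1[of H h] by (simp add: H'_def)
    moreover have "1 \<le> card {e \<in> H'. v \<in> e}" if v: "v \<in> V" for v
    proof (cases "v = x")
      case True
      then have "s \<in> {e \<in> H'. v \<in> e}"
        using s by (simp add: H'_def)
      moreover have "finite {e \<in> H'. v \<in> e}"
        using finH by (simp add: H'_def)
      ultimately show ?thesis
        by (metis One_nat_def Suc_leI card_gt_0_iff empty_iff)
    next
      case False
      have "{e \<in> H'. x \<in> e} \<subseteq> {s}"
        using xH by (auto simp: H'_def)
      then have "card {e \<in> H'. x \<in> e} \<le> 1"
        using card_mono[of "{s}"] by fastforce
      moreover have "card H' \<le> (card V - 2 choose 2) + (card {e \<in> H'. x \<in> e} + card {e \<in> H'. v \<in> e})"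
        using card_le_degree_sum[OF fin \<open>H' \<subseteq> nsets V 2\<close>, of "{x, v}"] x v False by (simp add: numeral_2_eq_2)
      ultimately show ?thesis
        using cH' H(3) t by linarith
    qed
    ultimately show thesis
      using that[of H'] H(3) by simp
  qed
qed

text \<open>Only the two vertices \<open>x\<close> and \<open>y\<close> of smallest degree in
  \<open>H\<close> can have degree below \<open>t\<close>, and together they lack at most
  \<open>t - 1\<close> edges. So \<open>t - 1\<close> further edges raise all degrees to
  \<open>t\<close>.\<close>

lemma rainbow_cover_min_degree:
  assumes fin: "finite V" and n: "2 * t + 2 \<le> card V" and t: "1 \<le> t"
    and col: "(card V - 2 choose 2) + t + 1 \<le> card (c ` nsets V 2)"
  obtains H X where "H \<subseteq> nsets V 2" "inj_on c H" "X \<subseteq> nsets V 2" "card X < t"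
    "card (H \<union> X) = (card V - 2 choose 2) + 2 * t"
    "\<And>v. v \<in> V \<Longrightarrow> t \<le> card {e \<in> H \<union> X. v \<in> e}"
proof -
  define k where "k = card V - 2"
  have k: "card V = k + 2" "2 * t \<le> k"
    using n by (auto simp: k_def)
  obtain H where H: "H \<subseteq> nsets V 2" "inj_on c H" "card H = (k choose 2) + t + 1"
      and pos: "\<And>v. v \<in> V \<Longrightarrow> 1 \<le> card {e \<in> H. v \<in> e}"
    using rainbow_subset_positive_degrees[OF fin n t col] k_def by metis
  define d where "d = (\<lambda>v. card {e \<in> H. v \<in> e})"
  have finH: "finite H"
    using finite_edges[OF fin H(1)] .
  have finK: "finite (nsets V 2)"
    using fin by (rule finite_imp_finite_nsets)
  have "V \<noteq> {}"
    using k by auto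
  then obtain x where x: "x \<in> V" "\<And>v. v \<in> V \<Longrightarrow> d x \<le> d v"
    using ex_has_least_nat[of "\<lambda>v. v \<in> V" _ d] by auto
  have "V - {x} \<noteq> {}"
    using k card_mono[of "{x}" V] by auto
  then obtain y0 where "y0 \<in> V - {x}"
    by blast
  then obtain y where y: "y \<in> V" "y \<noteq> x" "\<And>v. v \<in> V \<Longrightarrow> v \<noteq> x \<Longrightarrow> d y \<le> d v"
    using ex_has_least_nat[of "\<lambda>v. v \<in> V - {x}" y0 d] by auto
  have sum2: "t + 1 \<le> d x + d y"
    using card_le_degree_sum[OF fin H(1), of "{x, y}"] x(1) y(1,2) H(3) k(1) by (simp add: d_def)
  \<comment> \<open>Otherwise \<open>x\<close>, \<open>y\<close> and \<open>z\<close> all have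
    degree at most \<open>t - 1\<close>. Then \<open>H\<close> has at most
    \<open>(k - 1 choose 2) + 3 * t - 3\<close> edges, fewer than
    \<open>(k choose 2) + t + 1\<close> because \<open>2 * t \<le> k\<close>.\<close>
  have rest: "t \<le> d z" if z: "z \<in> V" "z \<noteq> x" "z \<noteq> y" for z
  proof (rule ccontr)
    assume "\<not> t \<le> d z"
    then have "d x + d y + d z + 3 \<le> 3 * t"
      using x(2)[OF z(1)] y(3)[OF z(1,2)] by simp
    moreover have "card H \<le> (card V - 3 choose 2) + (d x + (d y + d z))"
      using card_le_degree_sum[OF fin H(1), of "{x, y, z}"] x(1) y(1,2) z
      by (simp add: d_def numeral_3_eq_3)
    moreover have "k choose 2 = (k - 1) + (card V - 3 choose 2)"
      using k t choose_two_Suc[of "k - 1"] by simp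
    ultimately show False
      using H(3) k(2) t by linarith
  qed
  have star: "\<exists>X. X \<subseteq> nsets V 2 - H \<and> card X = t - d v \<and> (\<forall>e\<in>X. v \<in> e)" if v: "v \<in> V" for v
  proof -
    have "{e \<in> nsets V 2 - H. v \<in> e} = {e \<in> nsets V 2. v \<in> e} - {e \<in> H. v \<in> e}"
      by blast
    moreover have "{e \<in> H. v \<in> e} \<subseteq> {e \<in> nsets V 2. v \<in> e}" "finite {e \<in> H. v \<in> e}"
      using H(1) finH by auto
    ultimately have "card {e \<in> nsets V 2 - H. v \<in> e} = card V - 1 - d v"
      using card_star[OF fin v] by (simp add: d_def card_Diff_subset)
    then have "t - d v \<le> card {e \<in> nsets V 2 - H. v \<in> e}"
      using k by simp
    then obtain X where "X \<subseteq> {e \<in> nsets V 2 - H. v \<in> e}" "card X = t - d v"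
      using obtain_subset_with_card_n by metis
    then show ?thesis
      by blast
  qed
  obtain Xx where Xx: "Xx \<subseteq> nsets V 2 - H" "card Xx = t - d x" "\<And>e. e \<in> Xx \<Longrightarrow> x \<in> e"
    using star[OF x(1)] by blast
  obtain Xy where Xy: "Xy \<subseteq> nsets V 2 - H" "card Xy = t - d y" "\<And>e. e \<in> Xy \<Longrightarrow> y \<in> e"
    using star[OF y(1)] by blast
  have "1 \<le> d x"
    using pos[OF x(1)] by (simp add: d_def)
  \<comment> \<open>If \<open>d y < t\<close>, the bound comes from \<open>sum2\<close>; if
    \<open>d y \<ge> t\<close>, the second term vanishes and \<open>1 \<le> d x\<close> is what
    gives it. This is why isolated vertices had to be removed.\<close>
  then have "(t - d x) + (t - d y) \<le> t - 1"
    using sum2 x(2)[OF y(1)] by arith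
  then have small: "card (Xx \<union> Xy) \<le> t - 1"
    using card_Un_le[of Xx Xy] Xx(2) Xy(2) by linarith
  have "card (nsets V 2 - H) = (card V choose 2) - card H"
    using H(1) finH by (simp add: card_Diff_subset)
  also have "\<dots> = 2 * k - t"
    by (simp add: k(1) choose_two_Suc H(3))
  finally have "t - 1 \<le> card (nsets V 2 - H)"
    using k(2) by simp
  \<comment> \<open>The edges needed at \<open>x\<close> and \<open>y\<close> may number fewer than
    \<open>t - 1\<close>; padding gives \<open>H \<union> X\<close> exactly the intended
    size.\<close>
  then obtain X where X: "Xx \<union> Xy \<subseteq> X" "X \<subseteq> nsets V 2 - H" "card X = t - 1"
    using exists_subset_between[OF small _ _ finite_Diff[OF finK]] Xx(1) Xy(1) by (metis le_sup_iff)
  have finX: "finite X"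
    using X(2) finK by (meson finite_Diff finite_subset)
  have grow: "t \<le> card {e \<in> H \<union> X. v \<in> e}"
    if Y: "Y \<subseteq> X" "card Y = t - d v" "\<And>e. e \<in> Y \<Longrightarrow> v \<in> e" for v Y
  proof -
    have "card ({e \<in> H. v \<in> e} \<union> Y) = d v + (t - d v)"
      using Y X(2) finH finX finite_subset[OF Y(1)] unfolding d_def Y(2)[symmetric, unfolded d_def]
      by (intro card_Un_disjoint) auto
    moreover have "card ({e \<in> H. v \<in> e} \<union> Y) \<le> card {e \<in> H \<union> X. v \<in> e}"
      using Y finH finX by (intro card_mono) auto
    ultimately show ?thesis
      by linarith
  qed
  show thesis
  proof (rule that[of H X])
    show "card X < t"
      using X(3) t by simp
    show "card (H \<union> X) = (card V - 2 choose 2) + 2 * t"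
    proof -
      have "H \<inter> X = {}"
        using X(2) by blast
      then show ?thesis
        using card_Un_disjoint[OF finH finX] X(3) H(3) t by (simp add: k_def)
    qed
    fix v
    assume v: "v \<in> V"
    consider "v = x" | "v = y" | "v \<noteq> x" "v \<noteq> y"
      by blast
    then show "t \<le> card {e \<in> H \<union> X. v \<in> e}"
    proof cases
      case 3
      then show ?thesis
        using grow[of "{}" v] rest[OF v] by simp
    qed (use grow[of Xx x] grow[of Xy y] X(1) Xx Xy in auto)
  qed (use H X in auto)
qed

section \<open>Numbers of colors that force disjoint rainbow trees\<close>

lemma rainbow_trees_if_packing:
  assumes T: "tree_packing {..<n} (H \<union> X) t T" and HX: "H \<subseteq> nsets {..<n} 2" "X \<subseteq> nsets {..<n} 2"
    and c: "inj_on c H" and X: "card X < t"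
  shows "has_disjoint_rainbow_trees n t c"
proof -
  have finX: "finite X"
    using finite_edges[OF _ HX(2)] by simp
  have "H \<union> X - H \<subseteq> X"
    by blast
  then have "finite (H \<union> X - H)" "card (H \<union> X - H) < t"
    using X card_mono[OF finX] finite_subset[OF _ finX] by (blast intro: le_less_trans)+
  then obtain S where S: "tree_packing {..<n} (H \<union> X) t S" "\<And>i. i < t \<Longrightarrow> inj_on c (S i)"
    using rainbow_rearrangement[OF _ T c] by blast
  have "rainbow_spanning_tree n c (S i)" if "i < t" for i
    using S that
    by (auto simp: rainbow_spanning_tree_def spanning_tree_complete_def tree_graph_def complete_edges_def
        tree_packing_def sptree_def forest_acyclic)
  then show ?thesis
    using S(1) by (auto simp: has_disjoint_rainbow_trees_def tree_packing_def)
qed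

lemma many_colors_large:
  assumes "1 \<le> t" "2 * t + 2 \<le> n" "(n - 2 choose 2) + t < card (c ` complete_edges n)"
  shows "has_disjoint_rainbow_trees n t c"
proof -
  obtain H X where HX: "H \<subseteq> nsets {..<n} 2" "inj_on c H" "X \<subseteq> nsets {..<n} 2" "card X < t"
      "card (H \<union> X) = (card {..<n} - 2 choose 2) + 2 * t"
      "\<And>v. v \<in> {..<n} \<Longrightarrow> t \<le> card {e \<in> H \<union> X. v \<in> e}"
    using rainbow_cover_min_degree[of "{..<n}" t c] assms unfolding complete_edges_def by auto
  obtain T where "tree_packing {..<n} (H \<union> X) t T"
    using min_degree_tree_packing[of "{..<n}" t "H \<union> X"] HX assms(2) by auto
  then show ?thesis
    using rainbow_trees_if_packing HX by blast
qed

text \<open>For both values of \<open>n\<close> the claimed maximum is \<open>t * (n - 2)\<close>;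
  one more color yields a rainbow set that \<open>t - 1\<close> edges complete to
  \<open>t * (n - 1)\<close> edges. The set \<open>U\<close> from \<open>dense_tree_packing\<close>
  is everything, since more than \<open>2 * t\<close> vertices out of \<open>n\<close> are all of
  them.\<close>

lemma many_colors_small:
  assumes t: "1 \<le> t" and n: "n = 2 * t \<or> n = 2 * t + 1"
    and col: "t * (n - 1) < card (c ` complete_edges n) + t"
  shows "has_disjoint_rainbow_trees n t c"
proof -
  define m where "m = t * (n - 1) + 1 - t"
  have finK: "finite (nsets {..<n} 2)"
    by (simp add: finite_imp_finite_nsets)
  have "t \<le> t * (n - 1)"
    using t n by (cases "n - 1") auto
  then have m: "m + (t - 1) = t * (n - 1)"
    using t unfolding m_def by linarith
  have "m \<le> card (c ` nsets {..<n} 2)"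
    using col by (simp add: m_def complete_edges_def)
  then obtain H where H: "H \<subseteq> nsets {..<n} 2" "inj_on c H" "card H = m"
    using rainbow_subset by metis
  have finH: "finite H"
    using H(1) finK by (rule finite_subset)
  have "2 * (n choose 2) + n = n * n"
    by (rule two_times_choose_two)
  then have "t * (n - 1) \<le> n choose 2"
    using n t by (auto simp: algebra_simps diff_mult_distrib2)
  then have "t - 1 \<le> card (nsets {..<n} 2 - H)"
    using m H finH by (simp add: card_Diff_subset)
  then obtain X where X: "X \<subseteq> nsets {..<n} 2 - H" "card X = t - 1"
    using obtain_subset_with_card_n by metis
  have finX: "finite X"
    using X(1) finK by (meson finite_Diff finite_subset)
  have "card (H \<union> X) = card H + card X"
    using X finX finH by (intro card_Un_disjoint) auto
  then have "t * (card {..<n} - 1) \<le> card (H \<union> X)"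
    using m H(3) X(2) by simp
  moreover have "{..<n} \<noteq> {}" "H \<union> X \<subseteq> nsets {..<n} 2"
    using t n H X by (auto simp: lessThan_empty_iff)
  ultimately obtain U T where U: "U \<subseteq> {..<n}" "tree_packing U (H \<union> X) t T"
      "U = {..<n} \<or> t * (card U - 1) < card U choose 2"
    using dense_tree_packing[of "{..<n}" "H \<union> X" t] by (metis finite_lessThan)
  have "U = {..<n}"
    using U(3)
  proof
    assume "t * (card U - 1) < card U choose 2"
    then have "2 * t < card U"
      by (rule choose_two_gt)
    then show ?thesis
      using U(1) n card_seteq[of "{..<n}" U] by auto
  qed
  then show ?thesis
    using rainbow_trees_if_packing[of n H X t T c] U(2) H X t by auto
qed

section \<open>Lower bounds\<close>

text \<open>Color 0 is reserved for \<open>D\<close>; the shift by \<open>Suc\<close> keeps all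
  other colors away from it.\<close>

lemma collapse_coloring:
  assumes "finite E" "D \<subseteq> E" "D \<noteq> {}"
  obtains c :: "'b \<Rightarrow> nat" where "card (c ` E) = card E - card D + 1" "\<And>x. x \<in> D \<Longrightarrow> c x = 0"
proof -
  obtain f :: "'b \<Rightarrow> nat" where f: "inj_on f E"
    using finite_imp_inj_to_nat_seg[OF assms(1)] by metis
  define c where "c = (\<lambda>e. if e \<in> D then 0 else Suc (f e))"
  have "c ` E = insert 0 ((\<lambda>e. Suc (f e)) ` (E - D))"
    using assms(2,3) by (auto simp: c_def)
  moreover have "inj_on (\<lambda>e. Suc (f e)) (E - D)"
    using f by (auto simp: inj_on_def)
  ultimately have "card (c ` E) = card (E - D) + 1"
    using assms(1) by (auto simp: card_image card_insert_if)
  then show thesis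
    using that[of c] assms card_Diff_subset[of D E] by (simp add: c_def finite_subset)
qed

lemma rainbow_spanning_treeD:
  assumes "rainbow_spanning_tree n c F"
  shows "F \<subseteq> nsets {..<n} 2" "connected_graph {..<n} F" "finite F" "n \<le> Suc (card F)" "inj_on c F"
  using assms finite_edges[of "{..<n}" F] connected_card[of "{..<n}" F]
  by (auto simp: rainbow_spanning_tree_def spanning_tree_complete_def tree_graph_def complete_edges_def)

lemma rainbow_monochromatic_le_1:
  assumes "rainbow_spanning_tree n c F" "\<And>x. x \<in> D \<Longrightarrow> c x = 0"
  shows "card (F \<inter> D) \<le> 1"
proof -
  have "inj_on c (F \<inter> D)"
    using rainbow_spanning_treeD(5)[OF assms(1)] by (rule inj_on_subset) auto
  then have "card (F \<inter> D) = card (c ` (F \<inter> D))"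
    by (simp add: card_image)
  also have "\<dots> \<le> card {0 :: nat}"
    using assms(2) by (intro card_mono) auto
  finally show ?thesis
    by simp
qed

text \<open>A rainbow spanning tree has at most one edge in the monochromatic set \<open>D\<close>,
  hence at least \<open>n - 2\<close> outside it. For \<open>t\<close> disjoint trees there are not
  enough edges outside \<open>D\<close>.\<close>

lemma few_colors_small:
  assumes D: "D \<subseteq> complete_edges n" and mono: "\<And>x. x \<in> D \<Longrightarrow> c x = 0"
    and few: "(n choose 2) < t * (n - 2) + card D"
  shows "\<not> has_disjoint_rainbow_trees n t c"
proof
  assume "has_disjoint_rainbow_trees n t c"
  then obtain T where T: "\<And>i. i < t \<Longrightarrow> rainbow_spanning_tree n c (T i)" "disjoint_family_on T {..<t}"
    by (auto simp: has_disjoint_rainbow_trees_def)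
  have finK: "finite (complete_edges n)"
    by (simp add: complete_edges_def finite_imp_finite_nsets)
  have "t * (n - 2) = (\<Sum>i<t. n - 2)"
    by simp
  also have "\<dots> \<le> (\<Sum>i<t. card (T i - D))"
  proof (rule sum_mono)
    fix i
    assume "i \<in> {..<t}"
    then have i: "rainbow_spanning_tree n c (T i)"
      using T by simp
    have "card (T i - D) = card (T i) - card (T i \<inter> D)"
      using rainbow_spanning_treeD(3)[OF i] by (simp add: card_Diff_subset_Int)
    then show "n - 2 \<le> card (T i - D)"
      using rainbow_spanning_treeD(4)[OF i] rainbow_monochromatic_le_1[of n c "T i" D] i mono by simp
  qed
  also have "\<dots> = card (\<Union>i<t. T i - D)"
  proof (rule sum_card_disjoint[symmetric])
    show "disjoint_family_on (\<lambda>i. T i - D) {..<t}"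
      using T(2) by (auto simp: disjoint_family_on_def)
  qed (use T(1) rainbow_spanning_treeD(3) in blast)
  also have "\<dots> \<le> card (complete_edges n - D)"
    using T(1) rainbow_spanning_treeD(1) finK unfolding complete_edges_def
    by (intro card_mono) blast+
  also have "\<dots> = (n choose 2) - card D"
    using D finK by (simp add: card_Diff_subset finite_subset complete_edges_def)
  finally show False
    using few card_mono[OF finK D] by (simp add: complete_edges_def)
qed

lemma connected_cut:
  assumes "connected_graph V F" "x \<in> X" "x \<in> V" "y \<notin> X" "y \<in> V"
  obtains a b where "{a, b} \<in> F" "a \<in> X" "b \<notin> X"
proof -
  have "(x, y) \<in> {(x, y). {x, y} \<in> F}\<^sup>*"
    using assms by (auto simp: connected_graph_def)
  then have "\<exists>a b. {a, b} \<in> F \<and> a \<in> X \<and> b \<notin> X"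
    using assms(4)
  proof (induction rule: rtrancl_induct)
    case (step y z)
    then show ?case
      by (cases "y \<in> X") auto
  qed (use assms(2) in simp)
  then show thesis
    using that by blast
qed

text \<open>One of \<open>t\<close> disjoint trees avoids \<open>M\<close>. It has two edges at the
  vertices 0 and 1, and both receive color 0.\<close>

lemma few_colors_large:
  assumes n: "3 \<le> n" and mono: "\<And>x. x \<in> {e \<in> complete_edges n. 0 \<in> e \<or> 1 \<in> e} - M \<Longrightarrow> c x = 0"
    and M: "finite M" "card M < t"
  shows "\<not> has_disjoint_rainbow_trees n t c"
proof
  let ?S = "{e \<in> complete_edges n. 0 \<in> e \<or> 1 \<in> e}"
  assume "has_disjoint_rainbow_trees n t c"
  then obtain T where T: "\<And>i. i < t \<Longrightarrow> rainbow_spanning_tree n c (T i)" "disjoint_family_on T {..<t}"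
    by (auto simp: has_disjoint_rainbow_trees_def)
  obtain b where b: "b < t" "T b \<inter> M = {}"
    using disjoint_family_avoids[OF M T(2)] by metis
  note tree = rainbow_spanning_treeD[OF T(1)[OF b(1)]]
  obtain e1 e2 where e: "e1 \<in> T b" "e2 \<in> T b" "e1 \<noteq> e2" "0 \<in> e1 \<or> 1 \<in> e1" "0 \<in> e2 \<or> 1 \<in> e2"
  proof -
    obtain x y where xy: "{x, y} \<in> T b" "x \<in> {0}" "y \<notin> {0}"
      using connected_cut[OF tree(2), of 0 "{0}" 1] n by auto
    show thesis
    \<comment> \<open>If the edge leaving 0 ends at 1, a second edge leaves \<open>{0, 1}\<close>;
      otherwise a different edge leaves 1.\<close>
    proof (cases "y = 1")
      case True
      obtain v w where vw: "{v, w} \<in> T b" "v \<in> {0, 1}" "w \<notin> {0, 1}"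
        using connected_cut[OF tree(2), of 0 "{0, 1}" 2] n by auto
      then have "{v, w} \<noteq> {x, y}"
        using xy True by (auto simp: doubleton_eq_iff)
      then show thesis
        using that[of "{v, w}" "{x, y}"] vw xy by auto
    next
      case False
      obtain v w where vw: "{v, w} \<in> T b" "v \<in> {1}" "w \<notin> {1}"
        using connected_cut[OF tree(2), of 1 "{1}" 0] n by auto
      then have "{v, w} \<noteq> {x, y}"
        using xy False by (auto simp: doubleton_eq_iff)
      then show thesis
        using that[of "{v, w}" "{x, y}"] vw xy by auto
    qed
  qed
  then have "e1 \<in> ?S - M" "e2 \<in> ?S - M"
    using b(2) tree(1) by (auto simp: complete_edges_def)
  then have "c e1 = c e2"
    using mono by simp
  then show False
    using e tree(5) by (auto simp: inj_on_def)
qed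

lemma card_edges_at_0_1:
  assumes "2 \<le> n"
  shows "card {e \<in> complete_edges n. 0 \<in> e \<or> 1 \<in> e} + (n - 2 choose 2) = n choose 2"
proof -
  let ?S = "{e \<in> complete_edges n. 0 \<in> e \<or> 1 \<in> e}"
  have "complete_edges n - ?S = nsets ({..<n} - {0, 1}) 2"
    by (auto simp: complete_edges_def nsets_def)
  then have "card (complete_edges n - ?S) = n - 2 choose 2"
    using assms by (simp add: card_Diff_subset numeral_2_eq_2)
  moreover have "card ?S + card (complete_edges n - ?S) = card (complete_edges n)"
  proof -
    have "finite (complete_edges n)" "?S \<subseteq> complete_edges n"
      by (auto simp: complete_edges_def finite_imp_finite_nsets)
    then show ?thesis
      by (simp add: card_Diff_subset card_mono finite_subset)
  qed
  ultimately show ?thesis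
    by (simp add: complete_edges_def)
qed

text \<open>The alternative \<open>v = 0\<close> covers \<open>n = 2\<close>, \<open>t = 1\<close>,
  where no coloring avoids a rainbow spanning tree and \<open>Sup {} = 0\<close> supplies the
  value.\<close>

lemma rainbow_tree_number_eqI:
  assumes up: "\<And>c. v < card (c ` complete_edges n) \<Longrightarrow> has_disjoint_rainbow_trees n t c"
    and low: "v = 0 \<or> (\<exists>c. card (c ` complete_edges n) = v \<and> \<not> has_disjoint_rainbow_trees n t c)"
  shows "rainbow_tree_number n t = v"
proof (cases "avoiding_color_numbers n t = {}")
  case True
  then have "v = 0"
    using low by (auto simp: avoiding_color_numbers_def)
  then show ?thesis
    using True by (simp add: rainbow_tree_number_def Sup_nat_def)
next
  case False
  have le: "x \<le> v" if "x \<in> avoiding_color_numbers n t" for x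
    using that up by (auto simp: avoiding_color_numbers_def not_less[symmetric])
  have "v \<in> avoiding_color_numbers n t"
    using low
  proof
    assume "v = 0"
    then show ?thesis
      using False le by fastforce
  qed (auto simp: avoiding_color_numbers_def)
  then show ?thesis
    using le False finite_avoiding_color_numbers[of n t] rainbow_tree_number_eq_Max[of n t]
    by (auto intro: Max_eqI)
qed

lemma collapse_avoids_small:
  assumes "m \<le> n choose 2" "1 \<le> m" "(n choose 2) < t * (n - 2) + m"
  shows "\<exists>c. card (c ` complete_edges n) = (n choose 2) - m + 1 \<and> \<not> has_disjoint_rainbow_trees n t c"
proof -
  have cK: "card (complete_edges n) = n choose 2" and finK: "finite (complete_edges n)"
    by (auto simp: complete_edges_def finite_imp_finite_nsets)
  obtain D where D: "D \<subseteq> complete_edges n" "card D = m"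
    using assms(1) obtain_subset_with_card_n[of m "complete_edges n"] cK by auto
  have "D \<noteq> {}"
    using D assms(2) by auto
  then obtain c :: "nat set \<Rightarrow> nat" where "card (c ` complete_edges n) = (n choose 2) - m + 1" "\<And>x. x \<in> D \<Longrightarrow> c x = 0"
    using collapse_coloring[OF finK D(1)] cK D(2) by metis
  then show ?thesis
    using few_colors_small[OF D(1)] assms(3) D(2) by blast
qed

lemma collapse_avoids_large:
  assumes "1 \<le> t" "2 * t + 2 \<le> n"
  shows "\<exists>c. card (c ` complete_edges n) = (n - 2 choose 2) + t \<and> \<not> has_disjoint_rainbow_trees n t c"
proof -
  let ?S = "{e \<in> complete_edges n. 0 \<in> e \<or> 1 \<in> e}"
  have cK: "card (complete_edges n) = n choose 2" and finK: "finite (complete_edges n)"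
    by (auto simp: complete_edges_def finite_imp_finite_nsets)
  have cS: "card ?S + (n - 2 choose 2) = n choose 2"
    using card_edges_at_0_1 assms by simp
  define k where "k = n - 2"
  have k: "n = Suc (Suc k)" "2 * t \<le> k"
    using assms by (auto simp: k_def)
  have "n choose 2 = 2 * k + 1 + (k choose 2)"
    by (simp add: k choose_two_Suc)
  then have cS': "card ?S = 2 * k + 1"
    using cS k by simp
  then have "t - 1 \<le> card ?S"
    using k by simp
  \<comment> \<open>Each of the \<open>t - 1\<close> edges in \<open>M\<close> keeps its own color,
    which adds \<open>t - 1\<close> colors to the common one and those of the
    \<open>n - 2 choose 2\<close> edges away from 0 and 1.\<close>
  then obtain M where M: "M \<subseteq> ?S" "card M = t - 1" "finite M"
    by (rule obtain_subset_with_card_n)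
  have cD: "card (?S - M) = 2 * k + 1 - (t - 1)"
    using M cS' by (simp add: card_Diff_subset)
  then have "card (?S - M) \<noteq> 0"
    using k assms(1) by linarith
  then have ne: "?S - M \<noteq> {}"
    by (metis card.empty)
  have sub: "?S - M \<subseteq> complete_edges n"
    by auto
  obtain c :: "nat set \<Rightarrow> nat" where c: "card (c ` complete_edges n) = card (complete_edges n) - card (?S - M) + 1"
      "\<And>x. x \<in> ?S - M \<Longrightarrow> c x = 0"
    using collapse_coloring[OF finK sub ne] by blast
  have "card (c ` complete_edges n) = (n - 2 choose 2) + t"
    unfolding c(1) cK cD using cS cS' k assms(1) by simp
  moreover have "\<not> has_disjoint_rainbow_trees n t c"
    using few_colors_large[of n M c t] c(2) M assms by simp
  ultimately show ?thesis
    by blast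
qed

theorem theorem4:
  fixes n t :: nat
  assumes "t \<ge> 1"
  shows "(n \<ge> 2 * t + 2 \<longrightarrow> rainbow_tree_number n t = ((n - 2) choose 2) + t) \<and>
         (n = 2 * t + 1 \<longrightarrow> rainbow_tree_number n t = (n - 1) choose 2) \<and>
         (n = 2 * t \<longrightarrow> rainbow_tree_number n t = (n choose 2) - t)"
proof (intro conjI impI)
  assume "n \<ge> 2 * t + 2"
  then show "rainbow_tree_number n t = ((n - 2) choose 2) + t"
    using many_colors_large collapse_avoids_large assms
    by (intro rainbow_tree_number_eqI) auto
next
  assume n: "n = 2 * t + 1"
  have C: "n choose 2 = t * (2 * t + 1)" "(n - 1 choose 2) + t = t * (2 * t)"
    using two_times_choose_two[of n] two_times_choose_two[of "n - 1"] by (auto simp: n algebra_simps)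
  show "rainbow_tree_number n t = (n - 1) choose 2"
  proof (rule rainbow_tree_number_eqI)
    fix c :: "nat set \<Rightarrow> nat"
    assume "n - 1 choose 2 < card (c ` complete_edges n)"
    then show "has_disjoint_rainbow_trees n t c"
      using C(2) by (intro many_colors_small[OF assms]) (auto simp: n)
  next
    \<comment> \<open>The monochromatic set has \<open>2 * t + 1\<close> edges, the least size
      allowed by \<open>collapse_avoids_small\<close>: here \<open>t * (n - 2) + (2 * t + 1)\<close>
      exceeds \<open>n choose 2\<close> by one.\<close>
    have "(n choose 2) - (2 * t + 1) + 1 = n - 1 choose 2"
      using C assms by (cases t) (auto simp: algebra_simps)
    moreover have "2 * t + 1 \<le> n choose 2" "(n choose 2) < t * (n - 2) + (2 * t + 1)"
      using C(1) assms by (cases t; auto simp: n algebra_simps)+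
    ultimately show "n - 1 choose 2 = 0 \<or>
        (\<exists>c. card (c ` complete_edges n) = n - 1 choose 2 \<and> \<not> has_disjoint_rainbow_trees n t c)"
      using collapse_avoids_small[of "2 * t + 1" n t] by auto
  qed
next
  assume n: "n = 2 * t"
  obtain s where s: "t = Suc s"
    using assms by (cases t) auto
  have C: "n choose 2 = t * (2 * s + 1)"
    using two_times_choose_two[of n] by (auto simp: n s algebra_simps)
  show "rainbow_tree_number n t = (n choose 2) - t"
  proof (rule rainbow_tree_number_eqI)
    fix c :: "nat set \<Rightarrow> nat"
    assume "(n choose 2) - t < card (c ` complete_edges n)"
    then show "has_disjoint_rainbow_trees n t c"
      using C by (intro many_colors_small[OF assms]) (auto simp: n s)
  next
    show "(n choose 2) - t = 0 \<or>
        (\<exists>c. card (c ` complete_edges n) = (n choose 2) - t \<and> \<not> has_disjoint_rainbow_trees n t c)"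
    \<comment> \<open>For \<open>s = 0\<close>, that is \<open>t = 1\<close> and
      \<open>n = 2\<close>, the value is 0. Otherwise \<open>t + 1\<close> edges share a color,
      again the least size for which edge counting excludes the trees.\<close>
    proof (cases s)
      case 0
      then show ?thesis
        using C s by simp
    next
      case (Suc r)
      have "(n choose 2) - (t + 1) + 1 = (n choose 2) - t"
        using C by (simp add: s Suc)
      moreover have "t + 1 \<le> n choose 2" "(n choose 2) < t * (n - 2) + (t + 1)"
        using C by (auto simp: n s Suc algebra_simps)
      ultimately show ?thesis
        using collapse_avoids_small[of "t + 1" n t] by auto
    qed
  qed
qed

end
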